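(* Let $X$ be a densely defined self-adjoint operator on a Hilbert space $\mathcal{M}$, let $v\in\mathcal{M}$, let $C$ be a real constant, and let $P^1,\dots,P^d$ be (orthogonal) projections on $\mathcal{M}$ with pairwise orthogonal ranges that sum to the identity. Let $F$ be given by $$F(z)=C+\Big\langle\Big(X-\sum_{r=1}^dz^rP^r\Big)^{-1}v,v\Big\rangle .$$ Let $E$ be an open box in $\mathbb{R}^d$ that is contained in the $\mu$-resolvent of $X$. Then $F$ is globally operator monotone on $E$.
   Context: The $\mu$-resolvent of $X$ (with respect to $P^1,\dots,P^d$) is the set of points $z=(z^1,\dots,z^d)\in\mathbb{C}^d$ for which $X-\sum_{r=1}^dz^rP^r$ has a bounded inverse. An open box is a product of open intervals. $CSAM_n^d$ is the set of $d$-tuples $S=(S^1,\dots,S^d)$ of pairwise commuting self-adjoint $n\times n$ matrices; $S\le T$ means $S^r\le T^r$ for every $r$; for a function $f$ on the set of joint eigenvalues of $S$ (a subset of $\mathbb{R}^d$), $f(S)$ is defined by the joint functional calculus. A real-valued function $f$ on an open set $E\subseteq\mathbb{R}^d$ is globally operator monotone on $E$ if, for every $n$, whenever $S,T\in CSAM_n^d$ with $S\le T$ and the joint eigenvalues of both $S$ and $T$ lie in $E$, then $f(S)\le f(T)$. *)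

theory Defs
  imports
    "HOL-Analysis.Analysis"
    "Jordan_Normal_Form.Matrix"
    "Jordan_Normal_Form.Schur_Decomposition"
begin

subsection \<open>Complex Hilbert spaces and unbounded operators\<close>

text \<open>
  The inner product is linear in the first argument and conjugate-linear in the second.
  Completeness comes from \<^class>\<open>banach\<close>.
\<close>

class complex_hilbert_space = banach +
  fixes scaleC :: "complex \<Rightarrow> 'a \<Rightarrow> 'a"
    and cinner :: "'a \<Rightarrow> 'a \<Rightarrow> complex"
  assumes scaleC_add_right: "scaleC a (x + y) = scaleC a x + scaleC a y"
    and scaleC_add_left: "scaleC (a + b) x = scaleC a x + scaleC b x"
    and scaleC_scaleC: "scaleC a (scaleC b x) = scaleC (a * b) x"
    and scaleR_eq_scaleC: "scaleR r x = scaleC (complex_of_real r) x"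
    and cinner_commute: "cinner x y = cnj (cinner y x)"
    and cinner_add_left: "cinner (x + y) z = cinner x z + cinner y z"
    and cinner_scaleC_left: "cinner (scaleC a x) y = a * cinner x y"
    and cinner_self_ge_zero: "0 \<le> Re (cinner x x)"
    and cinner_self_eq_zero_iff: "cinner x x = 0 \<longleftrightarrow> x = 0"
    and norm_eq_sqrt_cinner: "norm x = sqrt (Re (cinner x x))"

definition complex_subspace :: "'a::complex_hilbert_space set \<Rightarrow> bool" where
  "complex_subspace D \<longleftrightarrow>
     0 \<in> D \<and> (\<forall>x\<in>D. \<forall>y\<in>D. x + y \<in> D) \<and> (\<forall>a. \<forall>x\<in>D. scaleC a x \<in> D)"

definition complex_linear_on ::
    "'a::complex_hilbert_space set \<Rightarrow> ('a \<Rightarrow> 'a) \<Rightarrow> bool" where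
  "complex_linear_on D X \<longleftrightarrow>
     (\<forall>x\<in>D. \<forall>y\<in>D. X (x + y) = X x + X y) \<and> (\<forall>a. \<forall>x\<in>D. X (scaleC a x) = scaleC a (X x))"

text \<open>
  An unbounded operator is given by its domain \<open>D\<close> together with a function \<open>X\<close> whose values
  outside \<open>D\<close> are irrelevant.  Its adjoint is represented by its graph (which is the graph of a
  function precisely when \<open>D\<close> is dense), and self-adjointness is equality of the two graphs,
  so that it includes equality of domains.
\<close>

definition adjoint_graph ::
    "'a::complex_hilbert_space set \<Rightarrow> ('a \<Rightarrow> 'a) \<Rightarrow> ('a \<times> 'a) set" where
  "adjoint_graph D X = {(y, z). \<forall>x\<in>D. cinner (X x) y = cinner x z}"

definition densely_defined_operator ::
    "'a::complex_hilbert_space set \<Rightarrow> ('a \<Rightarrow> 'a) \<Rightarrow> bool" where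
  "densely_defined_operator D X \<longleftrightarrow>
     complex_subspace D \<and> complex_linear_on D X \<and> closure D = UNIV"

definition self_adjoint_operator ::
    "'a::complex_hilbert_space set \<Rightarrow> ('a \<Rightarrow> 'a) \<Rightarrow> bool" where
  "self_adjoint_operator D X \<longleftrightarrow>
     densely_defined_operator D X \<and> (\<lambda>x. (x, X x)) ` D = adjoint_graph D X"

definition orthogonal_projection :: "('a::complex_hilbert_space \<Rightarrow> 'a) \<Rightarrow> bool" where
  "orthogonal_projection P \<longleftrightarrow>
     complex_linear_on UNIV P \<and> bounded_linear P \<and>
     (\<forall>x. P (P x) = P x) \<and> (\<forall>x y. cinner (P x) y = cinner x (P y))"

definition orthogonal_resolution ::
    "('d::finite \<Rightarrow> 'a::complex_hilbert_space \<Rightarrow> 'a) \<Rightarrow> bool" where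
  "orthogonal_resolution P \<longleftrightarrow>
     (\<forall>r. orthogonal_projection (P r)) \<and>
     (\<forall>r s. r \<noteq> s \<longrightarrow> (\<forall>x y. cinner (P r x) (P s y) = 0)) \<and>
     (\<forall>x. (\<Sum>r\<in>UNIV. P r x) = x)"

text \<open>
  Points of $\mathbb{C}^d$ and $\mathbb{R}^d$ are functions on a finite index type \<open>'d\<close>.
  As each \<open>P r\<close> is everywhere defined, the pencil below has the same domain \<open>D\<close> as \<open>X\<close>.
  Real linearity in \<^const>\<open>bounded_linear\<close> loses nothing: the inverse of a
  complex-linear bijection is complex linear.
\<close>

definition pencil ::
    "('a::complex_hilbert_space \<Rightarrow> 'a) \<Rightarrow> ('d::finite \<Rightarrow> 'a \<Rightarrow> 'a) \<Rightarrow> ('d \<Rightarrow> complex) \<Rightarrow> 'a \<Rightarrow> 'a" where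
  "pencil X P z = (\<lambda>x. X x - (\<Sum>r\<in>UNIV. scaleC (z r) (P r x)))"

definition has_bounded_inverse ::
    "'a::complex_hilbert_space set \<Rightarrow> ('a \<Rightarrow> 'a) \<Rightarrow> bool" where
  "has_bounded_inverse D A \<longleftrightarrow> bij_betw A D UNIV \<and> bounded_linear (inv_into D A)"

definition mu_resolvent ::
    "'a::complex_hilbert_space set \<Rightarrow> ('a \<Rightarrow> 'a) \<Rightarrow> ('d::finite \<Rightarrow> 'a \<Rightarrow> 'a) \<Rightarrow> ('d \<Rightarrow> complex) set" where
  "mu_resolvent D X P = {z. has_bounded_inverse D (pencil X P z)}"

definition complexify :: "('d \<Rightarrow> real) \<Rightarrow> 'd \<Rightarrow> complex" where
  "complexify x = (\<lambda>r. complex_of_real (x r))"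

text \<open>Open intervals may be unbounded.\<close>

definition open_box :: "('d::finite \<Rightarrow> real) set \<Rightarrow> bool" where
  "open_box E \<longleftrightarrow> (\<exists>I. (\<forall>r. open (I r) \<and> is_interval (I r)) \<and> E = {x. \<forall>r. x r \<in> I r})"

subsection \<open>Commuting tuples of self-adjoint matrices\<close>

definition self_adjoint_mat :: "nat \<Rightarrow> complex mat \<Rightarrow> bool" where
  "self_adjoint_mat n A \<longleftrightarrow> A \<in> carrier_mat n n \<and> mat_adjoint A = A"

definition unitary_mat :: "nat \<Rightarrow> complex mat \<Rightarrow> bool" where
  "unitary_mat n U \<longleftrightarrow>
     U \<in> carrier_mat n n \<and> mat_adjoint U * U = 1\<^sub>m n \<and> U * mat_adjoint U = 1\<^sub>m n"

definition CSAM :: "nat \<Rightarrow> ('d::finite \<Rightarrow> complex mat) set" where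
  "CSAM n = {S. (\<forall>r. self_adjoint_mat n (S r)) \<and> (\<forall>r s. S r * S s = S s * S r)}"

text \<open>
  The order on \<^typ>\<open>complex\<close> is that of \<^theory>\<open>HOL-Library.Complex_Order\<close>, in which
  nonnegative means real and nonnegative.
\<close>

definition mat_le :: "nat \<Rightarrow> complex mat \<Rightarrow> complex mat \<Rightarrow> bool" where
  "mat_le n A B \<longleftrightarrow> (\<forall>w\<in>carrier_vec n. 0 \<le> ((B - A) *\<^sub>v w) \<bullet>c w)"

definition joint_eigenvalues :: "nat \<Rightarrow> ('d::finite \<Rightarrow> complex mat) \<Rightarrow> ('d \<Rightarrow> real) set" where
  "joint_eigenvalues n S =
     {x. \<exists>w\<in>carrier_vec n. w \<noteq> 0\<^sub>v n \<and> (\<forall>r. S r *\<^sub>v w = complex_of_real (x r) \<cdot>\<^sub>v w)}"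

text \<open>
  If \<open>U\<close> jointly diagonalizes \<open>S\<close>, with the joint eigenvalues \<open>x 0, \<dots>, x (n - 1)\<close> listed with
  multiplicity, then $f(S) = U \, \mathrm{diag}(f(x_0), \dots, f(x_{n-1})) \, U^*$.  A joint
  diagonalization exists for every \<open>S\<close> in \<open>CSAM n\<close>, and the resulting matrix does not
  depend on its choice; it involves only values of \<open>f\<close> at joint eigenvalues of \<open>S\<close>.
\<close>

definition joint_calculus ::
    "nat \<Rightarrow> (('d::finite \<Rightarrow> real) \<Rightarrow> real) \<Rightarrow> ('d \<Rightarrow> complex mat) \<Rightarrow> complex mat" where
  "joint_calculus n f S =
     (THE A. \<exists>U x. unitary_mat n U \<and>
        (\<forall>r. S r = U * mat_diag n (\<lambda>i. complex_of_real (x i r)) * mat_adjoint U) \<and>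
        A = U * mat_diag n (\<lambda>i. complex_of_real (f (x i))) * mat_adjoint U)"

definition globally_operator_monotone ::
    "('d::finite \<Rightarrow> real) set \<Rightarrow> (('d \<Rightarrow> real) \<Rightarrow> real) \<Rightarrow> bool" where
  "globally_operator_monotone E f \<longleftrightarrow>
     (\<forall>n. \<forall>S\<in>CSAM n. \<forall>T\<in>CSAM n.
        (\<forall>r. mat_le n (S r) (T r)) \<longrightarrow>
        joint_eigenvalues n S \<subseteq> E \<longrightarrow> joint_eigenvalues n T \<subseteq> E \<longrightarrow>
        mat_le n (joint_calculus n f S) (joint_calculus n f T))"

end

theory Submission
  imports Defs "Jordan_Normal_Form.Spectral_Radius"
begin

text \<open>
  On \<open>M \<otimes> \<complex>\<^sup>n\<close> the quadratic form of \<open>F(S)\<close> at \<open>w\<close> is, up to the constant \<open>C\<close>, that of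
  \<open>(X \<otimes> 1 - \<Sum>\<^sub>r P\<^sup>r \<otimes> S\<^sup>r)\<^sup>-\<^sup>1\<close> at \<open>v \<otimes> w\<close>.  Along the segment from \<open>S\<close> to \<open>T\<close> its derivative
  is nonnegative, provided that the inverse exists there.  The difficulty is that the intermediate
  tuples need not commute.  After a shift and a scaling by \<open>\<Sum>\<^sub>r \<surd>e\<^sub>r P\<^sup>r\<close> the joint eigenvalues
  of \<open>S\<close> and \<open>T\<close> lie in the cube \<open>[-1, 1]\<^sup>d\<close>.  Write \<open>X\<close> for the transformed operator; since \<open>X - y\<close> is then invertible for all real \<open>y\<close>
  in \<open>[-1, 1]\<close>, the self-adjoint operator \<open>X\<^sup>-\<^sup>1\<close> is a strict contraction, while \<open>\<Sum>\<^sub>r P\<^sup>r \<otimes> B\<^sup>r\<close> is a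
  contraction for every convex combination \<open>B\<close> of the scaled tuples, so that the Neumann series
  converges.
\<close>

unbundle no vec_syntax
unbundle no inner_syntax

section \<open>Joint diagonalization of commuting self-adjoint matrices\<close>

text \<open>Two properties of the box matter. It contains the diagonal points \<open>c + t e\<close>
  with \<open>\<bar>t\<bar> \<le> 1\<close>; after the scaling the pencil at such a point is
  formally \<open>Y\<^sup>-\<^sup>1 - t\<close> with a scalar \<open>t\<close>, so invertibility
  along this single diagonal controls the norm of the bounded self-adjoint operator
  \<open>Y\<close>. And a bound by 1 at the two ends of the segment passes to the whole segment by
  the triangle inequality, whether or not the tuples there commute. The unbounded operator is not
  carried along the segment: its equation is rewritten as the fixed point equation
  \<open>h = Y (\<xi> + B h)\<close>, in which only \<open>B\<close> varies. Commutativity enters at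
  the two ends only. There the equation is solved explicitly from joint eigenvectors and from
  resolvents at joint eigenvalues, which identifies its quadratic form, up to \<open>C\<close>, with
  that of the functional calculus. Differentiation is replaced by a quadratic lower bound for
  increments over short steps.\<close>

lemma mat_adjoint_carrier:
  "A \<in> carrier_mat n m \<Longrightarrow> mat_adjoint A \<in> carrier_mat m n"
  unfolding mat_adjoint_def by (auto simp: mat_of_rows_def)

lemma mat_adjoint_index:
  fixes A :: "complex mat"
  assumes "A \<in> carrier_mat n m" "i < m" "j < n"
  shows "mat_adjoint A $$ (i, j) = cnj (A $$ (j, i))"
  using assms unfolding mat_adjoint_def
  by (auto simp: mat_of_rows_def conjugate_complex_def)

lemma mat_mult_index:
  assumes "A \<in> carrier_mat n m" "B \<in> carrier_mat m l" "i < n" "j < l"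
  shows "(A * B) $$ (i, j) = (\<Sum>k<m. A $$ (i, k) * B $$ (k, j))"
  using assms by (auto simp: scalar_prod_def atLeast0LessThan)

lemma mult_mat_vec_index:
  assumes "A \<in> carrier_mat n m" "w \<in> carrier_vec m" "i < n"
  shows "(A *\<^sub>v w) $ i = (\<Sum>k<m. A $$ (i, k) * w $ k)"
  using assms by (auto simp: scalar_prod_def atLeast0LessThan)

lemma mat_adjoint_adjoint:
  fixes A :: "complex mat"
  assumes A: "A \<in> carrier_mat n m"
  shows "mat_adjoint (mat_adjoint A) = A"
proof (rule eq_matI)
  note A' = mat_adjoint_carrier[OF A]
  note A'' = mat_adjoint_carrier[OF A']
  show "dim_row (mat_adjoint (mat_adjoint A)) = dim_row A" "dim_col (mat_adjoint (mat_adjoint A)) = dim_col A"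
    using A A'' by auto
  fix i j assume ij: "i < dim_row A" "j < dim_col A"
  then show "mat_adjoint (mat_adjoint A) $$ (i, j) = A $$ (i, j)"
    using A by (simp add: mat_adjoint_index[OF A'] mat_adjoint_index[OF A])
qed

lemma mat_adjoint_mult:
  fixes A :: "complex mat"
  assumes A: "A \<in> carrier_mat n m" and B: "B \<in> carrier_mat m l"
  shows "mat_adjoint (A * B) = mat_adjoint B * mat_adjoint A"
proof (rule eq_matI)
  note A' = mat_adjoint_carrier[OF A] and B' = mat_adjoint_carrier[OF B]
  have AB: "A * B \<in> carrier_mat n l" using A B by auto
  note AB' = mat_adjoint_carrier[OF AB]
  show "dim_row (mat_adjoint (A * B)) = dim_row (mat_adjoint B * mat_adjoint A)"
    "dim_col (mat_adjoint (A * B)) = dim_col (mat_adjoint B * mat_adjoint A)"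
    using AB' A' B' by auto
  fix i j assume "i < dim_row (mat_adjoint B * mat_adjoint A)" "j < dim_col (mat_adjoint B * mat_adjoint A)"
  then have ij: "i < l" "j < n" using A' B' by auto
  show "mat_adjoint (A * B) $$ (i, j) = (mat_adjoint B * mat_adjoint A) $$ (i, j)"
    unfolding mat_adjoint_index[OF AB ij] mat_mult_index[OF B' A' ij] mat_mult_index[OF A B ij(2,1)]
    using ij by (auto simp: mat_adjoint_index[OF A] mat_adjoint_index[OF B] mult.commute)
qed

lemma unitary_matD:
  assumes "unitary_mat n U"
  shows "U \<in> carrier_mat n n" "mat_adjoint U \<in> carrier_mat n n"
    "mat_adjoint U * U = 1\<^sub>m n" "U * mat_adjoint U = 1\<^sub>m n"
  using assms mat_adjoint_carrier unfolding unitary_mat_def by auto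

lemma unitary_matI:
  assumes U: "U \<in> carrier_mat n n" and "mat_adjoint U * U = 1\<^sub>m n"
  shows "unitary_mat n U"
  using mat_mult_left_right_inverse[OF mat_adjoint_carrier[OF U] U] assms unfolding unitary_mat_def by auto

lemma unitary_mat_mult:
  assumes U: "unitary_mat n U" and V: "unitary_mat n V"
  shows "unitary_mat n (U * V)"
proof (rule unitary_matI)
  note u = unitary_matD[OF U] and v = unitary_matD[OF V]
  show "U * V \<in> carrier_mat n n" using u v by auto
  have "mat_adjoint (U * V) * (U * V) = mat_adjoint V * ((mat_adjoint U * U) * V)"
    using u(1,2) v(1,2) by (simp add: mat_adjoint_mult[OF u(1) v(1)] assoc_mult_mat[of _ n n _ n _ n])
  then show "mat_adjoint (U * V) * (U * V) = 1\<^sub>m n" using u v by simp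
qed

lemma unitary_conjugation:
  assumes U: "unitary_mat n U" and A: "A \<in> carrier_mat n n"
  shows "U * (mat_adjoint U * A * U) * mat_adjoint U = A"
    "mat_adjoint U * (U * A * mat_adjoint U) * U = A"
proof -
  note u = unitary_matD[OF U]
  have "U * (mat_adjoint U * A * U) * mat_adjoint U = (U * mat_adjoint U) * A * (U * mat_adjoint U)"
    using u(1,2) A by (simp add: assoc_mult_mat[of _ n n _ n _ n])
  then show "U * (mat_adjoint U * A * U) * mat_adjoint U = A" using u A by simp
  have "mat_adjoint U * (U * A * mat_adjoint U) * U = (mat_adjoint U * U) * A * (mat_adjoint U * U)"
    using u(1,2) A by (simp add: assoc_mult_mat[of _ n n _ n _ n])
  then show "mat_adjoint U * (U * A * mat_adjoint U) * U = A" using u A by simp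
qed

lemma unitary_conjugation_mult:
  assumes U: "unitary_mat n U" and A: "A \<in> carrier_mat n n" and B: "B \<in> carrier_mat n n"
  shows "(mat_adjoint U * A * U) * (mat_adjoint U * B * U) = mat_adjoint U * (A * B) * U"
proof -
  note u = unitary_matD[OF U]
  have "(mat_adjoint U * A * U) * (mat_adjoint U * B * U) = mat_adjoint U * A * (U * mat_adjoint U) * (B * U)"
    using u(1,2) A B by (simp add: assoc_mult_mat[of _ n n _ n _ n])
  then show ?thesis using u A B by (simp add: assoc_mult_mat[of _ n n _ n _ n])
qed

lemma self_adjoint_conjugation:
  assumes U: "unitary_mat n U" and A: "self_adjoint_mat n A"
  shows "self_adjoint_mat n (mat_adjoint U * A * U)"
proof -
  note u = unitary_matD[OF U]
  from A have A: "A \<in> carrier_mat n n" "mat_adjoint A = A" unfolding self_adjoint_mat_def by auto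
  have AU: "mat_adjoint U * A \<in> carrier_mat n n" using A u by auto
  have "mat_adjoint (mat_adjoint U * A * U) = mat_adjoint U * A * U"
    unfolding mat_adjoint_mult[OF AU u(1)] mat_adjoint_mult[OF u(2) A(1)] mat_adjoint_adjoint[OF u(1)] A(2)
    using assoc_mult_mat[OF u(2) A(1) u(1)] by simp
  then show ?thesis unfolding self_adjoint_mat_def using u A by simp
qed

lemma CSAM_D:
  assumes "S \<in> CSAM n"
  shows "self_adjoint_mat n (S r)" "S r \<in> carrier_mat n n" "mat_adjoint (S r) = S r" "S r * S s = S s * S r"
  using assms unfolding CSAM_def self_adjoint_mat_def by auto

lemma CSAM_conjugation:
  assumes U: "unitary_mat n U" and S: "S \<in> CSAM n"
  shows "(\<lambda>r. mat_adjoint U * S r * U) \<in> CSAM n"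
  unfolding CSAM_def mem_Collect_eq
proof (intro conjI allI)
  note S' = CSAM_D[OF S]
  fix r s
  show "self_adjoint_mat n (mat_adjoint U * S r * U)" by (rule self_adjoint_conjugation[OF U S'(1)])
  show "mat_adjoint U * S r * U * (mat_adjoint U * S s * U) = mat_adjoint U * S s * U * (mat_adjoint U * S r * U)"
    unfolding unitary_conjugation_mult[OF U S'(2) S'(2)] S'(4)[of r s] ..
qed

section \<open>Deflation and joint diagonalization\<close>

text \<open>Gram-Schmidt applied to a basis that begins with \<open>w\<close> leaves
  \<open>w\<close> unchanged as the first vector. The resulting columns are orthogonal but not
  normalized, hence the scalar \<open>c\<close>.\<close>

lemma unitary_completion:
  fixes w :: "complex vec"
  assumes w: "w \<in> carrier_vec n" and w0: "w \<noteq> 0\<^sub>v n" and n: "0 < n"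
  obtains W c where "unitary_mat n W" "col W 0 = c \<cdot>\<^sub>v w"
proof -
  interpret cof_vec_space n "TYPE(complex)" .
  define b where "b = basis_completion w"
  define ws where "ws = gram_schmidt n b"
  note bc = basis_completion[OF w w0, folded b_def]
  from bc(6,7) n obtain vs where bv: "b = w # vs" by (cases b, auto)
  have ws: "set ws \<subseteq> carrier_vec n" "corthogonal ws" "length ws = n"
    using gram_schmidt_result[OF bc(2,4,5) refl, folded ws_def] bc(6) by auto
  have hdws: "hd ws = w" using gram_schmidt_hd[OF w, of vs, folded bv] unfolding ws_def .
  then have ws0: "ws ! 0 = w" using ws(3) n by (cases ws) auto
  define \<nu> where "\<nu> j = complex_of_real (sqrt (Re (ws ! j \<bullet>c ws ! j)))" for j
  define W where "W = Matrix.mat n n (\<lambda>(i, j). ws ! j $ i / \<nu> j)"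
  have W: "W \<in> carrier_mat n n" unfolding W_def by auto
  have Wij: "W $$ (i, j) = ws ! j $ i / \<nu> j" if "i < n" "j < n" for i j
    using that unfolding W_def by simp
  have wsj: "ws ! j \<in> carrier_vec n" if "j < n" for j using that ws by auto
  have ip: "ws ! j \<bullet>c ws ! i = (\<Sum>k<n. cnj (ws ! i $ k) * ws ! j $ k)" if "i < n" "j < n" for i j
    using wsj[OF that(1)] wsj[OF that(2)] by (simp add: scalar_prod_def atLeast0LessThan conjugate_complex_def mult.commute)
  have nu: "\<nu> j * \<nu> j = ws ! j \<bullet>c ws ! j" "\<nu> j \<noteq> 0" if "j < n" for j
  proof -
    have "0 \<le> ws ! j \<bullet>c ws ! j" by (rule conjugate_square_ge_0_vec)
    moreover have "ws ! j \<bullet>c ws ! j \<noteq> 0" using ws(2,3) that by (auto simp: corthogonal_def)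
    ultimately have "0 < Re (ws ! j \<bullet>c ws ! j)" "Im (ws ! j \<bullet>c ws ! j) = 0"
      by (auto simp: less_eq_complex_def complex_eq_iff)
    then show "\<nu> j * \<nu> j = ws ! j \<bullet>c ws ! j" "\<nu> j \<noteq> 0"
      unfolding \<nu>_def by (auto simp: complex_eq_iff simp flip: of_real_mult)
  qed
  have "mat_adjoint W * W = 1\<^sub>m n"
  proof (rule eq_matI)
    note W' = mat_adjoint_carrier[OF W]
    fix i j assume "i < dim_row (1\<^sub>m n)" "j < dim_col (1\<^sub>m n)"
    then have ij: "i < n" "j < n" by auto
    have "(mat_adjoint W * W) $$ (i, j) = (\<Sum>k<n. cnj (ws ! i $ k / \<nu> i) * (ws ! j $ k / \<nu> j))"
      unfolding mat_mult_index[OF W' W ij]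
      by (rule sum.cong) (use ij in \<open>auto simp: mat_adjoint_index[OF W] Wij\<close>)
    also have "\<dots> = (\<Sum>k<n. cnj (ws ! i $ k) * ws ! j $ k) / (\<nu> i * \<nu> j)"
      by (simp add: sum_divide_distrib \<nu>_def)
    also have "\<dots> = (ws ! j \<bullet>c ws ! i) / (\<nu> i * \<nu> j)" unfolding ip[OF ij] ..
    also have "\<dots> = 1\<^sub>m n $$ (i, j)"
      using ij ws(2,3) nu[OF ij(1)] by (cases "i = j") (auto simp: corthogonal_def)
    finally show "(mat_adjoint W * W) $$ (i, j) = 1\<^sub>m n $$ (i, j)" .
  qed (use W mat_adjoint_carrier[OF W] in auto)
  then have "unitary_mat n W" by (rule unitary_matI[OF W])
  moreover have "col W 0 = (1 / \<nu> 0) \<cdot>\<^sub>v w"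
    by (rule eq_vecI) (use w n ws0 in \<open>auto simp: W_def\<close>)
  ultimately show ?thesis by (rule that)
qed

text \<open>Since column 0 of \<open>W\<close> is an eigenvector, column 0 of \<open>B\<close> is
  \<open>l\<close> times the first unit vector. Self-adjointness of \<open>B\<close> then clears row
  0 and makes \<open>l\<close> real.\<close>

lemma deflated_block:
  assumes A: "self_adjoint_mat (Suc n) A" and W: "unitary_mat (Suc n) W"
    and ev: "A *\<^sub>v col W 0 = l \<cdot>\<^sub>v col W 0"
  defines "B \<equiv> mat_adjoint W * A * W"
  shows "l \<in> \<real>"
    "B = four_block_mat (Matrix.mat 1 1 (\<lambda>_. l)) (0\<^sub>m 1 n) (0\<^sub>m n 1)
           (Matrix.mat n n (\<lambda>(i, j). B $$ (Suc i, Suc j)))"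
proof -
  note w = unitary_matD[OF W]
  have Ac: "A \<in> carrier_mat (Suc n) (Suc n)" using A by (simp add: self_adjoint_mat_def)
  have Bs: "self_adjoint_mat (Suc n) B" unfolding B_def by (rule self_adjoint_conjugation[OF W A])
  have Bc: "B \<in> carrier_mat (Suc n) (Suc n)" using Bs by (simp add: self_adjoint_mat_def)
  have "col B 0 = mat_adjoint W *\<^sub>v (A *\<^sub>v col W 0)"
    unfolding B_def assoc_mult_mat[OF w(2) Ac w(1)] col_mult2[OF w(2) mult_carrier_mat[OF Ac w(1)] zero_less_Suc]
      col_mult2[OF Ac w(1) zero_less_Suc] ..
  also have "\<dots> = l \<cdot>\<^sub>v col (mat_adjoint W * W) 0" unfolding ev
    using w(1,2) mult_mat_vec[OF w(2), of "col W 0" l] by auto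
  also have "\<dots> = l \<cdot>\<^sub>v unit_vec (Suc n) 0" unfolding w(3) by simp
  finally have c0: "col B 0 = l \<cdot>\<^sub>v unit_vec (Suc n) 0" .
  have b: "B $$ (i, 0) = (if i = 0 then l else 0)" if "i < Suc n" for i
    using arg_cong[OF c0, of "\<lambda>v. v $ i"] that Bc by auto
  have cn: "B $$ (j, i) = cnj (B $$ (i, j))" if "i < Suc n" "j < Suc n" for i j
    using mat_adjoint_index[OF Bc that(2,1)] Bs by (simp add: self_adjoint_mat_def)
  show l: "l \<in> \<real>" using cn[of 0 0] b[of 0] by (simp add: complex_is_Real_iff complex_eq_iff)
  show "B = four_block_mat (Matrix.mat 1 1 (\<lambda>_. l)) (0\<^sub>m 1 n) (0\<^sub>m n 1)
           (Matrix.mat n n (\<lambda>(i, j). B $$ (Suc i, Suc j)))"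
    by (rule eq_matI) (use Bc b cn[of _ 0] in \<open>auto simp: cn[of _ 0] l[unfolded Reals_cnj_iff]\<close>)
qed


definition jointly_diagonalizes ::
    "nat \<Rightarrow> ('d::finite \<Rightarrow> complex mat) \<Rightarrow> complex mat \<Rightarrow> (nat \<Rightarrow> 'd \<Rightarrow> real) \<Rightarrow> bool" where
  "jointly_diagonalizes n S U x \<longleftrightarrow> unitary_mat n U \<and>
     (\<forall>r. S r = U * mat_diag n (\<lambda>i. complex_of_real (x i r)) * mat_adjoint U)"

lemma jointly_diagonalizes_conjugation:
  assumes W: "unitary_mat n W" and S: "\<And>r. S r \<in> carrier_mat n n"
    and D: "jointly_diagonalizes n (\<lambda>r. mat_adjoint W * S r * W) U x"
  shows "jointly_diagonalizes n S (W * U) x"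
  unfolding jointly_diagonalizes_def
proof (intro conjI allI)
  from D have U: "unitary_mat n U" unfolding jointly_diagonalizes_def by auto
  show "unitary_mat n (W * U)" by (rule unitary_mat_mult[OF W U])
  fix r
  note u = unitary_matD[OF U] and w = unitary_matD[OF W]
  let ?D = "mat_diag n (\<lambda>i. complex_of_real (x i r))"
  have "S r = W * (U * ?D * mat_adjoint U) * mat_adjoint W"
    using D unitary_conjugation(1)[OF W S[of r]] unfolding jointly_diagonalizes_def by metis
  moreover have "?D * mat_adjoint U \<in> carrier_mat n n" "U * (?D * mat_adjoint U) \<in> carrier_mat n n"
    using u(1,2) by (metis mat_diag_dim mult_carrier_mat)+
  ultimately show "S r = W * U * ?D * mat_adjoint (W * U)"
    using u(1,2) w(1,2) by (simp add: mat_adjoint_mult[OF w(1) u(1)] assoc_mult_mat[of _ n n _ n _ n])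
qed

text \<open>The return from a deflated tuple: the eigenvalue that was split off takes index 0 and
  shifts the remaining joint eigenvalues by one.\<close>

lemma jointly_diagonalizes_four_block:
  assumes D: "jointly_diagonalizes n S U x" and l: "\<And>r. l r \<in> \<real>"
  shows "jointly_diagonalizes (Suc n)
    (\<lambda>r. four_block_mat (Matrix.mat 1 1 (\<lambda>_. l r)) (0\<^sub>m 1 n) (0\<^sub>m n 1) (S r))
    (four_block_mat (1\<^sub>m 1) (0\<^sub>m 1 n) (0\<^sub>m n 1) U)
    (\<lambda>i. case i of 0 \<Rightarrow> (\<lambda>r. Re (l r)) | Suc j \<Rightarrow> x j)"
    (is "jointly_diagonalizes _ ?S ?V ?x")
  unfolding jointly_diagonalizes_def
proof (intro conjI allI)
  from D have U: "unitary_mat n U"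
    and SU: "\<And>r. S r = U * mat_diag n (\<lambda>i. complex_of_real (x i r)) * mat_adjoint U"
    unfolding jointly_diagonalizes_def by auto
  note u = unitary_matD[OF U]
  have V: "?V \<in> carrier_mat (Suc n) (Suc n)" using four_block_carrier_mat[OF _ u(1), of "1\<^sub>m 1" 1 1] by auto
  have V': "mat_adjoint ?V = four_block_mat (1\<^sub>m 1) (0\<^sub>m 1 n) (0\<^sub>m n 1) (mat_adjoint U)" (is "_ = ?V'")
  proof (rule eq_matI)
    fix i j assume "i < dim_row ?V'" "j < dim_col ?V'"
    then have ij: "i < Suc n" "j < Suc n" using u by auto
    show "mat_adjoint ?V $$ (i, j) = ?V' $$ (i, j)"
      unfolding mat_adjoint_index[OF V ij] using ij u mat_adjoint_index[OF u(1), of "i - 1" "j - 1"] by auto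
  qed (use mat_adjoint_carrier[OF V] u in auto)
  have "?V' * ?V = four_block_mat (1\<^sub>m 1) (0\<^sub>m 1 n) (0\<^sub>m n 1) (1\<^sub>m n)"
    using u by (subst mult_four_block_mat[of _ 1 1 _ n _ n _ _ 1 _ n]) auto
  also have "\<dots> = 1\<^sub>m (Suc n)" using four_block_one_mat[of 1 n] by simp
  finally show "unitary_mat (Suc n) ?V" using unitary_matI[OF V] unfolding V' by simp
  fix r
  let ?D = "mat_diag n (\<lambda>i. complex_of_real (x i r))"
  let ?L = "Matrix.mat 1 1 (\<lambda>_. l r)"
  have UD: "U * ?D \<in> carrier_mat n n" "U * ?D * mat_adjoint U \<in> carrier_mat n n" using u by auto
  have Dx: "mat_diag (Suc n) (\<lambda>i. complex_of_real (?x i r)) = four_block_mat ?L (0\<^sub>m 1 n) (0\<^sub>m n 1) ?D"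
    by (rule eq_matI) (use l[of r] in \<open>auto simp: mat_diag_def of_real_Re split: nat.splits\<close>)
  have "?V * mat_diag (Suc n) (\<lambda>i. complex_of_real (?x i r)) = four_block_mat ?L (0\<^sub>m 1 n) (0\<^sub>m n 1) (U * ?D)"
    unfolding Dx using u
    by (subst mult_four_block_mat[of _ 1 1 _ n _ n _ _ 1 _ n]) (auto simp: left_mult_zero_mat[OF mat_diag_dim])
  moreover have "four_block_mat ?L (0\<^sub>m 1 n) (0\<^sub>m n 1) (U * ?D) * ?V' = ?S r"
    unfolding SU using u UD
    by (subst mult_four_block_mat[of _ 1 1 _ n _ n _ _ 1 _ n])
      (auto simp: right_mult_zero_mat[OF UD(1)] left_add_zero_mat[OF UD(2)])
  ultimately show "?S r = ?V * mat_diag (Suc n) (\<lambda>i. complex_of_real (?x i r)) * mat_adjoint ?V"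
    unfolding V' by simp
qed

text \<open>Deflation by induction on \<open>n\<close>. The hypothesis covers all sizes and tuples
  because it is applied to the compressions as well. It is kept abstract because the argument runs
  twice: first for one matrix, where an eigenvector is at hand, and then for tuples, whose joint
  eigenvectors are found by means of the first case.\<close>

lemma joint_diagonalization_if_joint_eigenvector:
  assumes ev: "\<And>n S. 0 < n \<Longrightarrow> S \<in> (CSAM n :: ('d::finite \<Rightarrow> complex mat) set) \<Longrightarrow>
      \<exists>w\<in>carrier_vec n. w \<noteq> 0\<^sub>v n \<and> (\<forall>r. \<exists>l. S r *\<^sub>v w = l \<cdot>\<^sub>v w)"
    and S: "S \<in> (CSAM n :: ('d \<Rightarrow> complex mat) set)"
  shows "\<exists>U x. jointly_diagonalizes n S U x"
  using S
proof (induction n arbitrary: S)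
  case 0
  note S = CSAM_D[OF 0]
  have "jointly_diagonalizes 0 S (1\<^sub>m 0) (\<lambda>_ _. 0)"
    unfolding jointly_diagonalizes_def unitary_mat_def
    using S(2)[THEN carrier_matD(1)] S(2)[THEN carrier_matD(2)] mat_adjoint_carrier[of "1\<^sub>m 0" 0 0]
    by (auto intro!: eq_matI)
  then show ?case by blast
next
  case (Suc n)
  note S = CSAM_D[OF Suc.prems]
  obtain w l where w: "w \<in> carrier_vec (Suc n)" "w \<noteq> 0\<^sub>v (Suc n)" and l: "\<And>r. S r *\<^sub>v w = l r \<cdot>\<^sub>v w"
    using ev[OF _ Suc.prems] by (auto, metis)
  obtain W c where W: "unitary_mat (Suc n) W" and c: "col W 0 = c \<cdot>\<^sub>v w"
    by (rule unitary_completion[OF w zero_less_Suc])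
  have l': "S r *\<^sub>v col W 0 = l r \<cdot>\<^sub>v col W 0" for r
    unfolding c using mult_mat_vec[OF S(2) w(1)] l by (simp add: smult_smult_assoc mult.commute)
  define B where "B r = mat_adjoint W * S r * W" for r
  define T where "T r = Matrix.mat n n (\<lambda>(i, j). B r $$ (Suc i, Suc j))" for r
  let ?fb = "\<lambda>r. four_block_mat (Matrix.mat 1 1 (\<lambda>_. l r)) (0\<^sub>m 1 n) (0\<^sub>m n 1) (T r)"
  have l_real: "l r \<in> \<real>" and fb: "B r = ?fb r" for r
    using deflated_block[OF S(1) W l'] unfolding B_def T_def by auto
  have B: "B \<in> CSAM (Suc n)" using CSAM_conjugation[OF W Suc.prems] unfolding B_def .
  note B' = CSAM_D[OF B]
  have T: "T r \<in> carrier_mat n n" for r unfolding T_def by simp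
  have "T \<in> CSAM n" unfolding CSAM_def mem_Collect_eq self_adjoint_mat_def
  proof (intro conjI allI T)
    fix r s
    show "mat_adjoint (T r) = T r"
    proof (rule eq_matI)
      fix i j assume "i < dim_row (T r)" "j < dim_col (T r)"
      then have ij: "i < n" "j < n" unfolding T_def by auto
      then show "mat_adjoint (T r) $$ (i, j) = T r $$ (i, j)"
        unfolding mat_adjoint_index[OF T ij]
        using mat_adjoint_index[OF B'(2), of "Suc i" "Suc j" r] B'(3)[of r] by (simp add: T_def)
    qed (use T[of r] mat_adjoint_carrier[OF T[of r]] in auto)
    \<comment> \<open>With vanishing off-diagonal blocks the lower right corner is multiplicative,
      so commutativity passes from \<open>B\<close> to \<open>T\<close>.\<close>
    have prod: "B r * B s = four_block_mat (Matrix.mat 1 1 (\<lambda>_. l r * l s)) (0\<^sub>m 1 n) (0\<^sub>m n 1) (T r * T s)" for r s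
      unfolding fb using T[of r] T[of s]
      by (subst mult_four_block_mat[of _ 1 1 _ n _ n _ _ 1 _ n]) (auto simp: scalar_prod_def intro!: cong_four_block_mat eq_matI)
    show "T r * T s = T s * T r"
    proof (rule eq_matI)
      fix i j assume "i < dim_row (T s * T r)" "j < dim_col (T s * T r)"
      then have ij: "i < n" "j < n" using T[of s] T[of r] by auto
      have *: "(B r * B s) $$ (Suc i, Suc j) = (T r * T s) $$ (i, j)" for r s
        unfolding prod using ij T[of r] T[of s] by (subst index_mat_four_block) auto
      show "(T r * T s) $$ (i, j) = (T s * T r) $$ (i, j)"
        unfolding *[symmetric] B'(4)[of r s] ..
    qed (use T[of r] T[of s] in auto)
  qed
  from Suc.IH[OF this] obtain U x where "jointly_diagonalizes n T U x" by blast
  from jointly_diagonalizes_four_block[OF this, of l] l_real show ?case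
    using jointly_diagonalizes_conjugation[OF W, of S] S(2)
    unfolding fb[symmetric] B_def by blast
qed

text \<open>The assumption says entrywise that \<open>W $$ (i, j)\<close> can be nonzero only where
  every \<open>g r\<close> agrees on \<open>y i\<close> and \<open>x j\<close>; there
  \<open>f\<close> agrees too. One use compares two joint diagonalizations, the other shows that a
  matrix commuting with a diagonal one commutes with its spectral projections.\<close>

lemma unitary_intertwining:
  fixes x :: "nat \<Rightarrow> 'k" and f :: "'k \<Rightarrow> complex"
  assumes W: "W \<in> carrier_mat n n"
    and c: "\<And>r. mat_diag n (\<lambda>i. g r (y i)) * W = W * mat_diag n (\<lambda>i. g r (x i))"
    and sep: "\<And>i j. i < n \<Longrightarrow> j < n \<Longrightarrow> (\<And>r. g r (y i) = g r (x j)) \<Longrightarrow> f (y i) = f (x j)"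
  shows "mat_diag n (\<lambda>i. f (y i)) * W = W * mat_diag n (\<lambda>i. f (x i))"
proof (rule eq_matI)
  fix i j assume "i < dim_row (W * mat_diag n (\<lambda>i. f (x i)))" "j < dim_col (W * mat_diag n (\<lambda>i. f (x i)))"
  then have ij: "i < n" "j < n" using W by (auto simp: mat_diag_def)
  have "f (y i) * W $$ (i, j) = W $$ (i, j) * f (x j)"
  proof (cases "W $$ (i, j) = 0")
    case False
    have "g r (y i) * W $$ (i, j) = W $$ (i, j) * g r (x j)" for r
      using arg_cong[OF c[of r], of "\<lambda>A. A $$ (i, j)"] ij
      unfolding mat_diag_mult_left[OF W] mat_diag_mult_right[OF W] by simp
    then have "g r (y i) = g r (x j)" for r using False by (metis mult.commute mult_cancel_left)
    then show ?thesis using sep[OF ij] by (simp add: mult.commute)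
  qed simp
  then show "(mat_diag n (\<lambda>i. f (y i)) * W) $$ (i, j) = (W * mat_diag n (\<lambda>i. f (x i))) $$ (i, j)"
    unfolding mat_diag_mult_left[OF W] mat_diag_mult_right[OF W] using ij by simp
qed (use W in \<open>auto simp: mat_diag_def\<close>)

text \<open>A single matrix is a tuple indexed by \<open>unit\<close>, for which a joint eigenvector
  is an ordinary one and exists because a complex matrix of positive size has nonempty
  spectrum.\<close>

lemma self_adjoint_mat_diagonalization:
  assumes A: "self_adjoint_mat n A"
  shows "\<exists>U m. unitary_mat n U \<and> A = U * mat_diag n (\<lambda>i. complex_of_real (m i)) * mat_adjoint U"
proof -
  have ev: "\<exists>w\<in>carrier_vec n. w \<noteq> 0\<^sub>v n \<and> (\<forall>r. \<exists>l. S r *\<^sub>v w = l \<cdot>\<^sub>v w)"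
    if n: "0 < n" and S: "S \<in> CSAM n" for n and S :: "unit \<Rightarrow> complex mat"
  proof -
    note S = CSAM_D[OF S]
    obtain l w where "eigenvector (S ()) w l"
      using spectrum_non_empty[OF S(2)[of "()"] n] unfolding spectrum_def eigenvalue_def by auto
    then show ?thesis unfolding eigenvector_def using S(2)[of "()"] by auto
  qed
  have "(\<lambda>_::unit. A) \<in> CSAM n" using A unfolding CSAM_def by auto
  from joint_diagonalization_if_joint_eigenvector[OF ev this]
  obtain U x where "jointly_diagonalizes n (\<lambda>_::unit. A) U x" by blast
  then show ?thesis unfolding jointly_diagonalizes_def by (intro exI[of _ U] exI[of _ "\<lambda>i. x i ()"]) auto
qed

text \<open>A joint eigenvector \<open>w\<close> for \<open>R\<close> is projected onto an
  eigenspace of \<open>S r\<close>. The spectral projection commutes with every \<open>S s\<close>,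
  so the eigenvector equations for \<open>R\<close> survive; the eigenspace is chosen so that the
  projection of \<open>w\<close> is not zero.\<close>

lemma CSAM_joint_eigenvector:
  fixes S :: "'d::finite \<Rightarrow> complex mat"
  assumes n: "0 < n" and S: "S \<in> CSAM n" and "finite R"
  shows "\<exists>w\<in>carrier_vec n. w \<noteq> 0\<^sub>v n \<and> (\<forall>r\<in>R. \<exists>l. S r *\<^sub>v w = l \<cdot>\<^sub>v w)"
  using \<open>finite R\<close>
proof (induction R)
  case empty
  have "unit_vec n 0 \<noteq> (0\<^sub>v n :: complex vec)" using n by (metis index_unit_vec(1) index_zero_vec(1) zero_neq_one)
  then show ?case by (intro bexI[of _ "unit_vec n 0"]) auto
next
  case (insert r R)
  note S = CSAM_D[OF S]
  obtain w where w: "w \<in> carrier_vec n" "w \<noteq> 0\<^sub>v n" and ev: "\<And>s. s \<in> R \<Longrightarrow> \<exists>l. S s *\<^sub>v w = l \<cdot>\<^sub>v w"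
    using insert.IH by auto
  obtain U m where U: "unitary_mat n U" and Sr: "S r = U * mat_diag n (\<lambda>i. complex_of_real (m i)) * mat_adjoint U"
    using self_adjoint_mat_diagonalization[OF S(1)] by blast
  note u = unitary_matD[OF U]
  let ?M = "mat_diag n (\<lambda>i. complex_of_real (m i))"
  have M: "?M \<in> carrier_mat n n" by simp
  define z where "z = mat_adjoint U *\<^sub>v w"
  have z: "z \<in> carrier_vec n" unfolding z_def using u w by auto
  have Uz: "U *\<^sub>v z = w" unfolding z_def using u w by (simp add: assoc_mult_mat_vec[symmetric])
  have "z \<noteq> 0\<^sub>v n" using Uz w u by auto
  \<comment> \<open>\<open>z\<close> holds the coordinates of \<open>w\<close> in an eigenbasis of
    \<open>S r\<close>. A nonzero coordinate \<open>p\<close> selects an eigenvalue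
    \<open>m p\<close> whose eigenspace has a nonzero component of \<open>w\<close>.\<close>
  then obtain p where p: "p < n" "z $ p \<noteq> 0" using z by (metis eq_vecI carrier_vecD index_zero_vec)
  define E where "E = mat_diag n (\<lambda>i. if m i = m p then 1 else 0 :: complex)"
  have E: "E \<in> carrier_mat n n" unfolding E_def by simp
  have Ez: "E *\<^sub>v z \<in> carrier_vec n" using E z by auto
  define w' where "w' = U *\<^sub>v (E *\<^sub>v z)"
  have w': "w' \<in> carrier_vec n" unfolding w'_def using u E z by auto
  have Uw': "mat_adjoint U *\<^sub>v w' = E *\<^sub>v z"
    unfolding w'_def using u Ez by (simp add: assoc_mult_mat_vec[symmetric])
  have "(E *\<^sub>v z) $ p = (\<Sum>k<n. E $$ (p, k) * z $ k)" by (rule mult_mat_vec_index[OF E z p(1)])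
  also have "\<dots> = (\<Sum>k<n. if k = p then z $ p else 0)"
    by (rule sum.cong) (use p in \<open>auto simp: E_def mat_diag_def\<close>)
  finally have "(E *\<^sub>v z) $ p = z $ p" using p by simp
  moreover have "(mat_adjoint U *\<^sub>v 0\<^sub>v n) $ p = 0" using u p by simp
  ultimately have "w' \<noteq> 0\<^sub>v n" using Uw' p(2) by auto
  moreover have "\<exists>l. S s *\<^sub>v w' = l \<cdot>\<^sub>v w'" if "s \<in> insert r R" for s
  proof (cases "s = r")
    case True
    have "?M * E = complex_of_real (m p) \<cdot>\<^sub>m E"
      unfolding E_def mat_diag_diag by (rule eq_matI) (auto simp: mat_diag_def)
    then have "S r *\<^sub>v w' = U *\<^sub>v ((complex_of_real (m p) \<cdot>\<^sub>m E) *\<^sub>v z)"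
      unfolding Sr assoc_mult_mat[OF u(1) M u(2)]
      using u M E z w' Uw' assoc_mult_mat_vec[OF M E z]
      by (simp add: assoc_mult_mat_vec[OF u(1) mult_carrier_mat[OF M u(2)] w'] assoc_mult_mat_vec[OF M u(2) w'])
    also have "(complex_of_real (m p) \<cdot>\<^sub>m E) *\<^sub>v z = complex_of_real (m p) \<cdot>\<^sub>v (E *\<^sub>v z)"
      using E z by (intro eq_vecI) auto
    also have "U *\<^sub>v \<dots> = complex_of_real (m p) \<cdot>\<^sub>v w'"
      unfolding w'_def by (rule mult_mat_vec[OF u(1) Ez])
    finally show ?thesis using True by blast
  next
    case False
    with that have "s \<in> R" by simp
    from ev[OF this] obtain l where l: "S s *\<^sub>v w = l \<cdot>\<^sub>v w" by blast
    define B where "B = mat_adjoint U * S s * U"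
    have B: "B \<in> carrier_mat n n" unfolding B_def using u S(2) by auto
    have Ss: "S s = U * B * mat_adjoint U" unfolding B_def using unitary_conjugation(1)[OF U S(2)] by simp
    have "?M = mat_adjoint U * S r * U" unfolding Sr using unitary_conjugation(2)[OF U M] by simp
    then have "?M * B = B * ?M" unfolding B_def
      using unitary_conjugation_mult[OF U S(2) S(2), of r s] unitary_conjugation_mult[OF U S(2) S(2), of s r] S(4)[of r s]
      by simp
    \<comment> \<open>\<open>E\<close> is the indicator function of \<open>m p\<close> applied to
      \<open>?M\<close>, and \<open>B\<close> commutes with \<open>?M\<close>.\<close>
    then have EB: "E * B = B * E"
      unfolding E_def
      by (intro unitary_intertwining[where g = "\<lambda>_::unit. complex_of_real" and x = m and y = m
            and f = "\<lambda>t. if t = m p then 1 else 0", OF B]) auto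
    have Sv: "S s *\<^sub>v y = U *\<^sub>v (B *\<^sub>v (mat_adjoint U *\<^sub>v y))" if y: "y \<in> carrier_vec n" for y
      unfolding Ss assoc_mult_mat_vec[OF mult_carrier_mat[OF u(1) B] u(2) y]
      using assoc_mult_mat_vec[OF u(1) B] u(2) y by simp
    have "mat_adjoint U *\<^sub>v (U *\<^sub>v (B *\<^sub>v z)) = B *\<^sub>v z"
      using u(3) B z by (simp flip: assoc_mult_mat_vec[OF u(2,1)])
    then have "B *\<^sub>v z = mat_adjoint U *\<^sub>v (S s *\<^sub>v w)"
      unfolding Sv[OF w(1)] z_def by simp
    also have "\<dots> = l \<cdot>\<^sub>v z" unfolding l z_def by (rule mult_mat_vec[OF u(2) w(1)])
    finally have Bz: "B *\<^sub>v z = l \<cdot>\<^sub>v z" .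
    have "S s *\<^sub>v w' = U *\<^sub>v (B *\<^sub>v (mat_adjoint U *\<^sub>v w'))" by (rule Sv[OF w'])
    also have "\<dots> = U *\<^sub>v (E *\<^sub>v (B *\<^sub>v z))"
      unfolding Uw' using assoc_mult_mat_vec[OF B E z] assoc_mult_mat_vec[OF E B z] EB by simp
    also have "\<dots> = l \<cdot>\<^sub>v w'" unfolding Bz w'_def using mult_mat_vec[OF E z] mult_mat_vec[OF u(1) Ez] by simp
    finally show ?thesis by blast
  qed
  ultimately show ?case using w' by blast
qed

lemma CSAM_joint_diagonalization:
  fixes S :: "'d::finite \<Rightarrow> complex mat"
  assumes "S \<in> CSAM n"
  obtains U x where "jointly_diagonalizes n S U x"
proof -
  have ev: "\<exists>w\<in>carrier_vec n. w \<noteq> 0\<^sub>v n \<and> (\<forall>r. \<exists>l. S r *\<^sub>v w = l \<cdot>\<^sub>v w)"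
    if "0 < n" "S \<in> CSAM n" for n and S :: "'d \<Rightarrow> complex mat"
    using CSAM_joint_eigenvector[OF that finite[of UNIV]] by simp
  have "\<exists>U x. jointly_diagonalizes n S U x"
    by (rule joint_diagonalization_if_joint_eigenvector[OF _ assms]) (rule ev)
  then obtain U x where "jointly_diagonalizes n S U x" by blast
  then show ?thesis by (rule that)
qed

section \<open>Independence of the joint calculus from the diagonalization\<close>

text \<open>For the uniqueness demanded by the definite description, let \<open>V\<close> and
  \<open>y\<close> form a second diagonalization. Then \<open>mat_adjoint V * U\<close> intertwines
  the diagonal matrices of all coordinates, hence also those of \<open>f\<close>.\<close>

lemma joint_calculus_eq:
  assumes D: "jointly_diagonalizes n S U x"
  shows "joint_calculus n f S = U * mat_diag n (\<lambda>i. complex_of_real (f (x i))) * mat_adjoint U"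
  unfolding joint_calculus_def
proof (rule the_equality)
  show "\<exists>V y. unitary_mat n V \<and> (\<forall>r. S r = V * mat_diag n (\<lambda>i. complex_of_real (y i r)) * mat_adjoint V) \<and>
      U * mat_diag n (\<lambda>i. complex_of_real (f (x i))) * mat_adjoint U =
      V * mat_diag n (\<lambda>i. complex_of_real (f (y i))) * mat_adjoint V"
    using D unfolding jointly_diagonalizes_def by blast
next
  fix A
  assume "\<exists>V y. unitary_mat n V \<and> (\<forall>r. S r = V * mat_diag n (\<lambda>i. complex_of_real (y i r)) * mat_adjoint V) \<and>
      A = V * mat_diag n (\<lambda>i. complex_of_real (f (y i))) * mat_adjoint V"
  then obtain V y where V: "unitary_mat n V"
    and y: "\<And>r. S r = V * mat_diag n (\<lambda>i. complex_of_real (y i r)) * mat_adjoint V"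
    and A: "A = V * mat_diag n (\<lambda>i. complex_of_real (f (y i))) * mat_adjoint V" by blast
  from D have U: "unitary_mat n U"
    and x: "\<And>r. S r = U * mat_diag n (\<lambda>i. complex_of_real (x i r)) * mat_adjoint U"
    unfolding jointly_diagonalizes_def by auto
  note u = unitary_matD[OF U] and v = unitary_matD[OF V]
  define W where "W = mat_adjoint V * U"
  have W: "W \<in> carrier_mat n n" unfolding W_def using u v by auto
  have move: "mat_adjoint V * (V * D1 * mat_adjoint V) * U = D1 * W"
    "mat_adjoint V * (U * D1 * mat_adjoint U) * U = W * D1"
    if D1: "D1 \<in> carrier_mat n n" for D1
  proof -
    have "mat_adjoint V * (V * D1 * mat_adjoint V) * U = (mat_adjoint V * (V * D1 * mat_adjoint V) * V) * W"
    proof -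
      have "V * W = U" unfolding W_def assoc_mult_mat[OF v(1,2) u(1), symmetric] v(4) using u(1) by simp
      moreover have "mat_adjoint V * (V * D1 * mat_adjoint V) \<in> carrier_mat n n" using v D1 by auto
      ultimately show ?thesis using assoc_mult_mat[OF _ v(1) W] by metis
    qed
    then show "mat_adjoint V * (V * D1 * mat_adjoint V) * U = D1 * W" unfolding unitary_conjugation(2)[OF V D1] .
    have c: "U * D1 \<in> carrier_mat n n" "U * D1 * mat_adjoint U \<in> carrier_mat n n" using u D1 by auto
    have "mat_adjoint V * (U * D1 * mat_adjoint U) * U = mat_adjoint V * (U * D1 * (mat_adjoint U * U))"
      unfolding assoc_mult_mat[OF v(2) c(2) u(1)] assoc_mult_mat[OF c(1) u(2) u(1)] ..
    also have "\<dots> = W * D1" unfolding W_def u(3) right_mult_one_mat[OF c(1)] assoc_mult_mat[OF v(2) u(1) D1] ..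
    finally show "mat_adjoint V * (U * D1 * mat_adjoint U) * U = W * D1" .
  qed
  have "mat_diag n (\<lambda>i. complex_of_real (y i r)) * W = W * mat_diag n (\<lambda>i. complex_of_real (x i r))" for r
    using move(1)[of "mat_diag n (\<lambda>i. complex_of_real (y i r))"]
      move(2)[of "mat_diag n (\<lambda>i. complex_of_real (x i r))"] x[of r] y[of r] by simp
  then have c: "mat_diag n (\<lambda>i. complex_of_real (f (y i))) * W = W * mat_diag n (\<lambda>i. complex_of_real (f (x i)))"
    by (rule unitary_intertwining[where g = "\<lambda>r t. complex_of_real (t r)" and f = "\<lambda>t. complex_of_real (f t)", OF W])
      (metis ext of_real_eq_iff)
  let ?B = "U * mat_diag n (\<lambda>i. complex_of_real (f (x i))) * mat_adjoint U"
  have Ac: "A \<in> carrier_mat n n" and Bc: "?B \<in> carrier_mat n n" unfolding A using u v by auto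
  have "mat_adjoint V * A * U = mat_adjoint V * ?B * U"
    unfolding A using move c by simp
  moreover have "V * (mat_adjoint V * C * U) * mat_adjoint U = C" if C: "C \<in> carrier_mat n n" for C
  proof -
    have "V * (mat_adjoint V * C * U) * mat_adjoint U = (V * mat_adjoint V) * C * (U * mat_adjoint U)"
      using u(1,2) v(1,2) C by (simp add: assoc_mult_mat[of _ n n _ n _ n])
    then show ?thesis using u v C by simp
  qed
  ultimately show "A = ?B" using Ac Bc by metis
qed

section \<open>Monotonicity of symmetric resolvent forms\<close>

lemma scaleC_zero_left: "scaleC 0 (x::'a::complex_hilbert_space) = 0"
  using scaleR_eq_scaleC[of 0 x] by simp

lemma scaleC_one: "scaleC 1 (x::'a::complex_hilbert_space) = x"
  using scaleR_eq_scaleC[of 1 x] by simp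

lemma scaleC_zero_right: "scaleC a (0::'a::complex_hilbert_space) = 0"
  using scaleC_add_right[of a 0 0] by simp

lemma scaleC_minus_left: "scaleC (- a) (x::'a::complex_hilbert_space) = - scaleC a x"
  using scaleC_add_left[of a "- a" x] by (simp add: scaleC_zero_left eq_neg_iff_add_eq_0 add.commute)

lemma scaleC_diff_left: "scaleC (a - b) (x::'a::complex_hilbert_space) = scaleC a x - scaleC b x"
  using scaleC_add_left[of a "- b" x] by (simp add: scaleC_minus_left)

lemma scaleC_diff_right: "scaleC a (x - y) = scaleC a x - scaleC a (y::'a::complex_hilbert_space)"
  using scaleC_add_right[of a "x - y" y] by simp

lemma scaleC_sum_right: "scaleC a (\<Sum>i\<in>A. f i) = (\<Sum>i\<in>A. scaleC a (f i :: 'a::complex_hilbert_space))"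
  by (induction A rule: infinite_finite_induct) (auto simp: scaleC_zero_right scaleC_add_right)

lemma scaleC_sum_left: "scaleC (\<Sum>i\<in>A. f i) x = (\<Sum>i\<in>A. scaleC (f i) (x :: 'a::complex_hilbert_space))"
  by (induction A rule: infinite_finite_induct) (auto simp: scaleC_zero_left scaleC_add_left)

lemma scaleC_scaleR: "scaleC a (t *\<^sub>R x) = t *\<^sub>R scaleC a (x::'a::complex_hilbert_space)"
  by (simp add: scaleR_eq_scaleC scaleC_scaleC mult.commute)

lemma cinner_add_right: "cinner x (y + z) = cinner x y + cinner x (z::'a::complex_hilbert_space)"
  by (metis cinner_add_left cinner_commute complex_cnj_add)

lemma cinner_scaleC_right: "cinner x (scaleC a y) = cnj a * cinner x (y::'a::complex_hilbert_space)"
  by (metis cinner_commute cinner_scaleC_left complex_cnj_mult)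

lemma cinner_scaleR_left: "cinner (t *\<^sub>R x) y = of_real t * cinner x (y::'a::complex_hilbert_space)"
  by (simp add: scaleR_eq_scaleC cinner_scaleC_left)

lemma cinner_scaleR_right: "cinner x (t *\<^sub>R y) = of_real t * cinner x (y::'a::complex_hilbert_space)"
  by (simp add: scaleR_eq_scaleC cinner_scaleC_right)

lemma cinner_zero_left: "cinner 0 (y::'a::complex_hilbert_space) = 0"
  using cinner_scaleR_left[of 0 0 y] by simp

lemma cinner_zero_right: "cinner (x::'a::complex_hilbert_space) 0 = 0"
  using cinner_scaleR_right[of x 0 0] by simp

lemma cinner_diff_left: "cinner (x - y) z = cinner x z - cinner y (z::'a::complex_hilbert_space)"
  using cinner_add_left[of "x - y" y z] by simp

lemma cinner_diff_right: "cinner x (y - z) = cinner x y - cinner x (z::'a::complex_hilbert_space)"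
  using cinner_add_right[of x "y - z" z] by simp

lemma cinner_sum_left: "cinner (\<Sum>i\<in>A. f i) y = (\<Sum>i\<in>A. cinner (f i) (y::'a::complex_hilbert_space))"
  by (induction A rule: infinite_finite_induct) (auto simp: cinner_zero_left cinner_add_left)

lemma cinner_sum_right: "cinner x (\<Sum>i\<in>A. f i) = (\<Sum>i\<in>A. cinner x (f i::'a::complex_hilbert_space))"
  by (induction A rule: infinite_finite_induct) (auto simp: cinner_zero_right cinner_add_right)

lemma cinner_self: "cinner x x = of_real ((norm (x::'a::complex_hilbert_space))\<^sup>2)"
proof -
  have "Im (cinner x x) = 0" using arg_cong[OF cinner_commute[of x x], of Im] by simp
  then show ?thesis
    using cinner_self_ge_zero[of x] by (simp add: norm_eq_sqrt_cinner complex_eq_iff)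
qed

lemma norm_scaleC: "norm (scaleC a x) = cmod a * norm (x::'a::complex_hilbert_space)"
proof -
  have "of_real ((norm (scaleC a x))\<^sup>2) = a * cnj a * cinner x x"
    unfolding cinner_self[symmetric] cinner_scaleC_left cinner_scaleC_right by (simp add: mult.assoc)
  also have "\<dots> = of_real ((cmod a * norm x)\<^sup>2)"
    unfolding cinner_self complex_norm_square[symmetric] by (simp add: power_mult_distrib)
  finally have "(norm (scaleC a x))\<^sup>2 = (cmod a * norm x)\<^sup>2" unfolding of_real_eq_iff .
  then show ?thesis by (rule power2_eq_imp_eq) auto
qed

lemma Re_cinner_commute: "Re (cinner x y) = Re (cinner y (x::'a::complex_hilbert_space))"
  by (subst cinner_commute) simp

lemma abs_Re_cinner_le: "\<bar>Re (cinner x y)\<bar> \<le> norm x * norm (y::'a::complex_hilbert_space)"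
proof (cases "x = 0 \<or> y = 0")
  case False
  then have pos: "0 < norm x * norm y" by simp
  let ?a = "norm x" and ?b = "norm y"
  \<comment> \<open>Expanding this square and taking \<open>e\<close> to be \<open>?a\<close> and
    \<open>- ?a\<close> gives the two signs of the Cauchy-Schwarz inequality.\<close>
  have n: "Re (cinner (?b *\<^sub>R x - e *\<^sub>R y) (?b *\<^sub>R x - e *\<^sub>R y)) \<ge> 0" for e
    by (rule cinner_self_ge_zero)
  have "0 \<le> ?b\<^sup>2 * ?a\<^sup>2 - 2 * e * ?b * Re (cinner x y) + e\<^sup>2 * ?b\<^sup>2" for e
    using n[of e] Re_cinner_commute[of x y]
    by (simp add: cinner_diff_left cinner_diff_right cinner_scaleR_left cinner_scaleR_right cinner_self[of x] cinner_self[of y]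
         power2_eq_square algebra_simps)
  from this[of ?a] this[of "- ?a"]
  have "(?a * ?b) * Re (cinner x y) \<le> (?a * ?b) * (?a * ?b)" "(?a * ?b) * - Re (cinner x y) \<le> (?a * ?b) * (?a * ?b)"
    by (simp_all add: power2_eq_square algebra_simps)
  then have "Re (cinner x y) \<le> ?a * ?b" "- Re (cinner x y) \<le> ?a * ?b"
    using pos mult_le_cancel_left_pos by blast+
  then show ?thesis by simp
qed (auto simp: cinner_zero_left cinner_zero_right)

section \<open>Tuples of vectors as elements of a tensor product\<close>

text \<open>A tuple \<open>x\<close> encodes the sum of \<open>x i \<otimes> e\<^sub>i\<close> over
  \<open>i < n\<close>, whatever its values at larger indices. This is the real part of the inner
  product there, and \<open>tnorm\<close> is the corresponding norm. Real parts suffice for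
  comparing quadratic forms of symmetric operators.\<close>

definition tinner :: "nat \<Rightarrow> (nat \<Rightarrow> 'a::complex_hilbert_space) \<Rightarrow> (nat \<Rightarrow> 'a) \<Rightarrow> real" where
  "tinner n x y = (\<Sum>i<n. Re (cinner (x i) (y i)))"

definition tnorm :: "nat \<Rightarrow> (nat \<Rightarrow> 'a::complex_hilbert_space) \<Rightarrow> real" where
  "tnorm n x = L2_set (\<lambda>i. norm (x i)) {..<n}"

lemma tinner_cong: "(\<And>i. i < n \<Longrightarrow> x i = x' i) \<Longrightarrow> (\<And>i. i < n \<Longrightarrow> y i = y' i) \<Longrightarrow> tinner n x y = tinner n x' y'"
  unfolding tinner_def by (rule sum.cong) auto

lemma tnorm_cong: "(\<And>i. i < n \<Longrightarrow> x i = x' i) \<Longrightarrow> tnorm n x = tnorm n x'"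
  unfolding tnorm_def by (rule L2_set_cong) auto

lemma tinner_commute: "tinner n x y = tinner n y x"
  unfolding tinner_def by (rule sum.cong[OF refl]) (rule Re_cinner_commute)

lemma tinner_left:
  "tinner n (\<lambda>i. x i + y i) z = tinner n x z + tinner n y z"
  "tinner n (\<lambda>i. x i - y i) z = tinner n x z - tinner n y z"
  "tinner n (\<lambda>i. t *\<^sub>R x i) z = t * tinner n x z"
  unfolding tinner_def
  by (simp_all add: cinner_add_left cinner_diff_left cinner_scaleR_left sum.distrib sum_subtractf sum_distrib_left)

lemma tinner_right:
  "tinner n z (\<lambda>i. x i + y i) = tinner n z x + tinner n z y"
  "tinner n z (\<lambda>i. x i - y i) = tinner n z x - tinner n z y"
  "tinner n z (\<lambda>i. t *\<^sub>R x i) = t * tinner n z x"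
  unfolding tinner_commute[of n z] tinner_left by simp_all

lemma tnorm_nonneg: "0 \<le> tnorm n x"
  unfolding tnorm_def by (rule L2_set_nonneg)

lemma tnorm_add: "tnorm n (\<lambda>i. x i + y i) \<le> tnorm n x + tnorm n y"
proof -
  have "tnorm n (\<lambda>i. x i + y i) \<le> L2_set (\<lambda>i. norm (x i) + norm (y i)) {..<n}"
    unfolding tnorm_def by (rule L2_set_mono) (auto simp: norm_triangle_ineq)
  also have "\<dots> \<le> tnorm n x + tnorm n y" unfolding tnorm_def by (rule L2_set_triangle_ineq)
  finally show ?thesis .
qed

lemma tnorm_scaleR: "tnorm n (\<lambda>i. t *\<^sub>R x i) = \<bar>t\<bar> * tnorm n x"
  unfolding tnorm_def by (simp add: L2_set_right_distrib)

lemma tnorm_diff: "tnorm n (\<lambda>i. x i - y i) \<le> tnorm n x + tnorm n y"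
  using tnorm_add[of n x "\<lambda>i. (- 1) *\<^sub>R y i"] unfolding tnorm_scaleR by simp

lemma norm_le_tnorm: "i < n \<Longrightarrow> norm (x i) \<le> tnorm n x"
  unfolding tnorm_def using member_le_L2_set[of "{..<n}" i "\<lambda>i. norm (x i)"] by simp

lemma tnorm_power2: "(tnorm n x)\<^sup>2 = (\<Sum>i<n. (norm (x i))\<^sup>2)"
  unfolding tnorm_def L2_set_def by (simp add: sum_nonneg)

lemma abs_tinner_le: "\<bar>tinner n x y\<bar> \<le> tnorm n x * tnorm n y"
proof -
  have "\<bar>tinner n x y\<bar> \<le> (\<Sum>i<n. \<bar>norm (x i)\<bar> * \<bar>norm (y i)\<bar>)"
    unfolding tinner_def by (intro order_trans[OF sum_abs] sum_mono) (simp add: abs_Re_cinner_le)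
  also have "\<dots> \<le> tnorm n x * tnorm n y" unfolding tnorm_def by (rule L2_set_mult_ineq)
  finally show ?thesis .
qed

lemma tnorm_map_le:
  assumes "\<And>u. norm (Y u) \<le> q * norm u" "0 \<le> q"
  shows "tnorm n (\<lambda>i. Y (x i)) \<le> q * tnorm n x"
proof -
  have "tnorm n (\<lambda>i. Y (x i)) \<le> L2_set (\<lambda>i. q * norm (x i)) {..<n}"
    unfolding tnorm_def by (rule L2_set_mono) (use assms in auto)
  also have "\<dots> = q * tnorm n x" unfolding tnorm_def by (rule L2_set_right_distrib[OF assms(2), symmetric])
  finally show ?thesis .
qed

definition block_op :: "nat \<Rightarrow> (nat \<Rightarrow> nat \<Rightarrow> 'a \<Rightarrow> 'a) \<Rightarrow> (nat \<Rightarrow> 'a) \<Rightarrow> nat \<Rightarrow> 'a::complex_hilbert_space" where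
  "block_op n \<beta> x i = (\<Sum>j<n. \<beta> i j (x j))"

lemma block_op_diff:
  assumes "\<And>i j. bounded_linear (\<beta> i j)"
  shows "block_op n \<beta> (\<lambda>j. x j - y j) i = block_op n \<beta> x i - block_op n \<beta> y i"
  unfolding block_op_def by (simp add: bounded_linear.linear[OF assms] linear_diff sum_subtractf)

section \<open>Neumann series and monotonicity along a segment\<close>

text \<open>The solution is the sum of \<open>(Y B)\<^sup>k Y \<xi>\<close>. The contraction
  property holds for whole tuples, whereas the series is summed in each coordinate;
  \<open>norm_le_tnorm\<close> hands the geometric bound on.\<close>

lemma neumann_fixpoint:
  fixes Y :: "'a::complex_hilbert_space \<Rightarrow> 'a"
  assumes Y: "bounded_linear Y" and \<beta>: "\<And>i j. bounded_linear (\<beta> i j)"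
    and q: "\<And>u. norm (Y u) \<le> q * norm u" "0 \<le> q" "q < 1"
    and B: "\<And>x. tnorm n (block_op n \<beta> x) \<le> tnorm n x"
  shows "\<exists>h. \<forall>i<n. h i = Y (\<xi> i + block_op n \<beta> h i)"
proof -
  define s where "s k = ((\<lambda>x i. Y (block_op n \<beta> x i)) ^^ k) (\<lambda>i. Y (\<xi> i))" for k
  have s_Suc: "s (Suc k) = (\<lambda>i. Y (block_op n \<beta> (s k) i))" for k unfolding s_def by simp
  have s_le: "tnorm n (s k) \<le> q ^ k * tnorm n (s 0)" for k
  proof (induction k)
    case (Suc k)
    have "tnorm n (s (Suc k)) \<le> q * tnorm n (block_op n \<beta> (s k))"
      unfolding s_Suc by (rule tnorm_map_le[OF q(1,2)])
    also have "\<dots> \<le> q * (q ^ k * tnorm n (s 0))"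
      by (intro mult_left_mono q order_trans[OF B Suc])
    finally show ?case by simp
  qed simp
  define h where "h i = (\<Sum>k. s k i)" for i
  have sums: "(\<lambda>k. s k i) sums h i" if i: "i < n" for i
  proof -
    have "summable (\<lambda>k. q ^ k * tnorm n (s 0))" using q by (intro summable_mult2 summable_geometric) auto
    then have "summable (\<lambda>k. s k i)"
      by (rule summable_comparison_test'[where N = 0]) (rule order_trans[OF norm_le_tnorm[OF i] s_le])
    then show ?thesis unfolding h_def by (rule summable_sums)
  qed
  have "h i = Y (\<xi> i + block_op n \<beta> h i)" if i: "i < n" for i
  proof -
    have "(\<lambda>k. block_op n \<beta> (s k) i) sums block_op n \<beta> h i"
      unfolding block_op_def by (intro sums_sum bounded_linear.sums[OF \<beta>] sums) auto
    then have "(\<lambda>k. s (Suc k) i) sums Y (block_op n \<beta> h i)"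
      unfolding s_Suc by (rule bounded_linear.sums[OF Y])
    then have "(\<lambda>k. s k i) sums (Y (block_op n \<beta> h i) + s 0 i)" by (rule sums_Suc)
    then have "h i = Y (block_op n \<beta> h i) + s 0 i" using sums[OF i] sums_unique2 by blast
    then show ?thesis by (simp add: s_def linear_add[OF bounded_linear.linear[OF Y]] add.commute)
  qed
  then show ?thesis by blast
qed

text \<open>Over \<open>Suc N\<close> equal steps the losses add up to \<open>C / Suc N\<close>,
  which tends to zero. This stands in for a nonnegative derivative.\<close>

lemma mono_if_quadratic_lower_bound:
  fixes f :: "real \<Rightarrow> real"
  assumes "\<And>s t. 0 \<le> s \<Longrightarrow> s \<le> t \<Longrightarrow> t \<le> 1 \<Longrightarrow> f s - C * (t - s)\<^sup>2 \<le> f t"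
  shows "f 0 \<le> f 1"
proof -
  have "f 0 - C * inverse (real (Suc N)) \<le> f 1" for N
  proof -
    let ?g = "\<lambda>k. f (real k / real (Suc N))"
    have "?g k - C / (real (Suc N))\<^sup>2 \<le> ?g (Suc k)" if "k < Suc N" for k
    proof -
      have "real (Suc k) / real (Suc N) - real k / real (Suc N) = 1 / real (Suc N)"
        unfolding diff_divide_distrib[symmetric] by simp
      then show ?thesis
        using assms[of "real k / real (Suc N)" "real (Suc k) / real (Suc N)"] that
        by (simp only: power_divide) (simp add: field_simps)
    qed
    then have "(\<Sum>k<Suc N. - (C / (real (Suc N))\<^sup>2)) \<le> (\<Sum>k<Suc N. ?g (Suc k) - ?g k)"
      by (intro sum_mono) (simp add: algebra_simps)
    also have "\<dots> = f 1 - f 0" by (subst sum_lessThan_telescope) (simp del: of_nat_Suc)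
    finally have "- (real (Suc N) * (C / (real (Suc N))\<^sup>2)) \<le> f 1 - f 0" by simp
    moreover have "real (Suc N) * (C / (real (Suc N))\<^sup>2) = C * inverse (real (Suc N))"
      by (simp add: power2_eq_square field_simps del: of_nat_Suc)
    ultimately show ?thesis by linarith
  qed
  moreover have "(\<lambda>N. f 0 - C * inverse (real (Suc N))) \<longlonglongrightarrow> f 0 - C * 0"
    by (intro tendsto_intros LIMSEQ_inverse_real_of_nat)
  ultimately show ?thesis using LIMSEQ_le_const2[of _ "f 0" "f 1"] by auto
qed

text \<open>
  The derivative of \<open>tinner n (h t) \<xi>\<close> along the segment from \<open>B0\<close> to \<open>B1\<close> is
  \<open>tinner n ((B1 - B0) (h t)) (h t)\<close>, where \<open>h t = Y (\<xi> + ((1 - t) B0 + t B1) (h t))\<close>.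
\<close>

lemma resolvent_form_mono:
  fixes Y :: "'a::complex_hilbert_space \<Rightarrow> 'a"
  assumes Y: "bounded_linear Y" and Ysym: "\<And>u v. cinner (Y u) v = cinner u (Y v)"
    and q: "\<And>u. norm (Y u) \<le> q * norm u" "0 \<le> q" "q < 1"
    and lin: "\<And>i j. bounded_linear (\<beta>0 i j)" "\<And>i j. bounded_linear (\<beta>1 i j)"
    and contr: "\<And>x. tnorm n (block_op n \<beta>0 x) \<le> tnorm n x" "\<And>x. tnorm n (block_op n \<beta>1 x) \<le> tnorm n x"
    and sym: "\<And>x y. tinner n (block_op n \<beta>0 x) y = tinner n x (block_op n \<beta>0 y)"
      "\<And>x y. tinner n (block_op n \<beta>1 x) y = tinner n x (block_op n \<beta>1 y)"
    and le: "\<And>x. tinner n (block_op n \<beta>0 x) x \<le> tinner n (block_op n \<beta>1 x) x"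
    and h0: "\<And>i. i < n \<Longrightarrow> h0 i = Y (\<xi> i + block_op n \<beta>0 h0 i)"
    and h1: "\<And>i. i < n \<Longrightarrow> h1 i = Y (\<xi> i + block_op n \<beta>1 h1 i)"
  shows "tinner n h0 \<xi> \<le> tinner n h1 \<xi>"
proof -
  define \<beta> where "\<beta> t i j u = (1 - t) *\<^sub>R \<beta>0 i j u + t *\<^sub>R \<beta>1 i j u" for t i j u
  define B where "B t = block_op n (\<beta> t)" for t
  define K where "K x i = block_op n \<beta>1 x i - block_op n \<beta>0 x i" for x i
  have \<beta>_lin: "bounded_linear (\<beta> t i j)" for t i j
    unfolding \<beta>_def by (intro bounded_linear_add bounded_linear_scaleR_right[THEN bounded_linear_compose] lin)
  have B_eq: "B t x = (\<lambda>i. (1 - t) *\<^sub>R block_op n \<beta>0 x i + t *\<^sub>R block_op n \<beta>1 x i)" for t x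
    unfolding B_def block_op_def \<beta>_def by (simp add: sum.distrib scaleR_sum_right)
  have B_step: "B t x i = B s x i + (t - s) *\<^sub>R K x i" for t s x i
    unfolding B_eq K_def by (simp add: algebra_simps)
  have B_sym: "tinner n (B t x) y = tinner n x (B t y)" for t x y
    unfolding B_eq by (simp add: tinner_left tinner_right sym)
  have B_contr: "tnorm n (B t x) \<le> tnorm n x" if "0 \<le> t" "t \<le> 1" for t x
  proof -
    have "tnorm n (B t x) \<le> (1 - t) * tnorm n (block_op n \<beta>0 x) + t * tnorm n (block_op n \<beta>1 x)"
      unfolding B_eq using that by (intro order_trans[OF tnorm_add]) (simp add: tnorm_scaleR)
    also have "\<dots> \<le> (1 - t) * tnorm n x + t * tnorm n x"
      using that by (intro add_mono mult_left_mono contr) auto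
    finally show ?thesis by (simp add: algebra_simps)
  qed
  have K_le: "tnorm n (K x) \<le> 2 * tnorm n x" for x
  proof -
    have "tnorm n (K x) \<le> tnorm n (block_op n \<beta>1 x) + tnorm n (block_op n \<beta>0 x)"
      unfolding K_def by (rule tnorm_diff)
    then show ?thesis using contr[of x] by linarith
  qed
  have K_pos: "0 \<le> tinner n (K x) x" for x
    unfolding K_def using le[of x] by (simp add: tinner_left)
  \<comment> \<open>No uniqueness of the fixed point is established, so the choice is tied to the
    prescribed solutions at both ends.\<close>
  have "\<exists>h. (\<forall>i<n. h i = Y (\<xi> i + B t h i)) \<and> (t = 0 \<longrightarrow> h = h0) \<and> (t = 1 \<longrightarrow> h = h1)"
    if "0 \<le> t" "t \<le> 1" for t
  proof -
    consider "t = 0" | "t = 1" | "t \<noteq> 0" "t \<noteq> 1" by blast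
    then show ?thesis
    proof cases
      case 1 then show ?thesis using h0 by (intro exI[of _ h0]) (auto simp: B_eq)
    next
      case 2 then show ?thesis using h1 by (intro exI[of _ h1]) (auto simp: B_eq)
    next
      case 3
      then show ?thesis using neumann_fixpoint[OF Y \<beta>_lin q B_contr[OF that, unfolded B_def], of \<xi>]
        unfolding B_def by auto
    qed
  qed
  then have "\<forall>t\<in>{0..1}. \<exists>h. (\<forall>i<n. h i = Y (\<xi> i + B t h i)) \<and> (t = 0 \<longrightarrow> h = h0) \<and> (t = 1 \<longrightarrow> h = h1)"
    by simp
  from bchoice[OF this] obtain h where
    h': "\<forall>t\<in>{0..1}. (\<forall>i<n. h t i = Y (\<xi> i + B t (h t) i)) \<and> (t = 0 \<longrightarrow> h t = h0) \<and> (t = 1 \<longrightarrow> h t = h1)"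
    by (rule exE)
  have h: "h t i = Y (\<xi> i + B t (h t) i)" if "0 \<le> t" "t \<le> 1" "i < n" for t i
    using bspec[OF h', of t] that by simp
  have h01: "h 0 = h0" "h 1 = h1" using bspec[OF h', of 0] bspec[OF h', of 1] by simp_all
  \<comment> \<open>A bound for all solutions at once: from
    \<open>h t = Y (\<xi> + B t (h t))\<close> follows
    \<open>(1 - q) * tnorm n (h t) \<le> q * tnorm n \<xi>\<close>.\<close>
  define M where "M = tnorm n \<xi> / (1 - q)"
  have h_le: "tnorm n (h t) \<le> M" if t: "0 \<le> t" "t \<le> 1" for t
  proof -
    have "tnorm n (h t) = tnorm n (\<lambda>i. Y (\<xi> i + B t (h t) i))" by (rule tnorm_cong) (rule h[OF t])
    also have "\<dots> \<le> q * tnorm n (\<lambda>i. \<xi> i + B t (h t) i)" by (rule tnorm_map_le[OF q(1,2)])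
    also have "\<dots> \<le> q * (tnorm n \<xi> + tnorm n (h t))"
      by (intro mult_left_mono order_trans[OF tnorm_add] add_left_mono B_contr t q(2))
    finally have "(1 - q) * tnorm n (h t) \<le> q * tnorm n \<xi>" by (simp add: algebra_simps)
    also have "\<dots> \<le> tnorm n \<xi>" using q tnorm_nonneg[of n \<xi>] by (simp add: mult_left_le_one_le)
    finally show ?thesis unfolding M_def using q by (simp add: field_simps)
  qed
  have Ytsym: "tinner n (\<lambda>i. Y (x i)) y = tinner n x (\<lambda>i. Y (y i))" for x y
    unfolding tinner_def Ysym ..
  \<comment> \<open>In the constant, one factor \<open>2 * M\<close> bounds \<open>K (h s)\<close>,
    and \<open>2 * M * (t - s) / (1 - q)\<close> bounds the increment \<open>d\<close> of the
    solution.\<close>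
  have "tinner n (h s) \<xi> - 4 * M\<^sup>2 / (1 - q) * (t - s)\<^sup>2 \<le> tinner n (h t) \<xi>"
    if st: "0 \<le> s" "s \<le> t" "t \<le> 1" for s t
  proof -
    have s: "0 \<le> s" "s \<le> 1" and t: "0 \<le> t" "t \<le> 1" using st by auto
    define d where "d i = h t i - h s i" for i
    \<comment> \<open>Symmetry of \<open>Y\<close> between the two right-hand sides. After
      cancellation of the operator terms this acts as a resolvent identity for the increment of the
      form.\<close>
    have pq: "tinner n (h t) (\<lambda>i. \<xi> i + B s (h s) i) = tinner n (h s) (\<lambda>i. \<xi> i + B t (h t) i)"
    proof -
      have "tinner n (h t) (\<lambda>i. \<xi> i + B s (h s) i) = tinner n (\<lambda>i. Y (\<xi> i + B t (h t) i)) (\<lambda>i. \<xi> i + B s (h s) i)"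
        by (rule tinner_cong) (auto simp: h[OF t])
      also have "\<dots> = tinner n (\<lambda>i. \<xi> i + B t (h t) i) (\<lambda>i. Y (\<xi> i + B s (h s) i))" by (rule Ytsym)
      also have "\<dots> = tinner n (\<lambda>i. \<xi> i + B t (h t) i) (h s)" by (rule tinner_cong) (auto simp: h[OF s])
      finally show ?thesis by (simp add: tinner_commute)
    qed
    have "tinner n (h t) \<xi> - tinner n (h s) \<xi> = tinner n (B t (h s)) (h t) - tinner n (B s (h s)) (h t)"
      using pq B_sym[of t "h s" "h t"] tinner_commute[of n "h t" "B s (h s)"] by (simp add: tinner_right)
    also have "B t (h s) = (\<lambda>i. B s (h s) i + (t - s) *\<^sub>R K (h s) i)" by (rule ext) (rule B_step)
    also have "tinner n \<dots> (h t) - tinner n (B s (h s)) (h t) = (t - s) * tinner n (K (h s)) (h t)"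
      by (simp add: tinner_left)
    \<comment> \<open>Freezing the solution at \<open>s\<close> leaves the nonnegative form of
      \<open>K\<close>; the remainder with \<open>d\<close> is of first order in
      \<open>t - s\<close> and is multiplied by another \<open>t - s\<close>.\<close>
    also have "tinner n (K (h s)) (h t) = tinner n (K (h s)) (h s) + tinner n (K (h s)) d"
      unfolding d_def by (simp add: tinner_right)
    finally have diff: "tinner n (h t) \<xi> - tinner n (h s) \<xi> = (t - s) * (tinner n (K (h s)) (h s) + tinner n (K (h s)) d)" .
    have Bd: "B t (h t) i - B s (h s) i = B t d i + (t - s) *\<^sub>R K (h s) i" for i
      using B_step[of t "h s" i s] block_op_diff[where n = n and x = "h t" and y = "h s" and i = i and \<beta> = "\<beta> t", OF \<beta>_lin]
      unfolding d_def B_def[symmetric] by simp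
    have "d i = Y (B t d i + (t - s) *\<^sub>R K (h s) i)" if "i < n" for i
      unfolding Bd[symmetric] linear_diff[OF bounded_linear.linear[OF Y]]
      using h[OF s that] h[OF t that] unfolding d_def
      by (simp add: linear_add[OF bounded_linear.linear[OF Y]])
    then have "tnorm n d = tnorm n (\<lambda>i. Y (B t d i + (t - s) *\<^sub>R K (h s) i))" by (rule tnorm_cong)
    also have "\<dots> \<le> q * tnorm n (\<lambda>i. B t d i + (t - s) *\<^sub>R K (h s) i)" by (rule tnorm_map_le[OF q(1,2)])
    also have "\<dots> \<le> q * (tnorm n d + (t - s) * (2 * M))"
    proof (intro mult_left_mono order_trans[OF tnorm_add] add_mono B_contr t q(2))
      have "tnorm n (\<lambda>i. (t - s) *\<^sub>R K (h s) i) = (t - s) * tnorm n (K (h s))"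
        using st by (simp add: tnorm_scaleR)
      also have "\<dots> \<le> (t - s) * (2 * M)"
        using K_le[of "h s"] h_le[OF s] st by (intro mult_left_mono) auto
      finally show "tnorm n (\<lambda>i. (t - s) *\<^sub>R K (h s) i) \<le> (t - s) * (2 * M)" .
    qed
    finally have "(1 - q) * tnorm n d \<le> q * ((t - s) * (2 * M))" by (simp add: algebra_simps)
    also have "\<dots> \<le> (t - s) * (2 * M)"
      using q st order_trans[OF tnorm_nonneg h_le[OF s]] by (intro mult_left_le_one_le) auto
    finally have d_le: "tnorm n d \<le> 2 * M * (t - s) / (1 - q)" using q by (simp add: field_simps)
    have "- tinner n (K (h s)) d \<le> tnorm n (K (h s)) * tnorm n d" using abs_tinner_le[of n "K (h s)" d] by linarith
    also have "\<dots> \<le> (2 * M) * (2 * M * (t - s) / (1 - q))"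
      using K_le[of "h s"] h_le[OF s] d_le by (intro mult_mono tnorm_nonneg) (use order_trans[OF tnorm_nonneg h_le[OF s]] in auto)
    finally have "- (tinner n (K (h s)) (h s) + tinner n (K (h s)) d) \<le> 4 * M\<^sup>2 / (1 - q) * (t - s)"
      using K_pos[of "h s"] by (simp add: power2_eq_square algebra_simps)
    then have "(t - s) * - (tinner n (K (h s)) (h s) + tinner n (K (h s)) d) \<le> (t - s) * (4 * M\<^sup>2 / (1 - q) * (t - s))"
      using st by (intro mult_left_mono) auto
    moreover have "(t - s) * (4 * M\<^sup>2 / (1 - q) * (t - s)) = 4 * M\<^sup>2 / (1 - q) * (t - s)\<^sup>2"
      by (simp add: power2_eq_square)
    ultimately show ?thesis using diff unfolding mult_minus_right by linarith
  qed
  then have "tinner n (h 0) \<xi> \<le> tinner n (h 1) \<xi>" by (rule mono_if_quadratic_lower_bound)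
  then show ?thesis unfolding h01 .
qed

section \<open>Orthogonal resolutions of the identity\<close>

text \<open>
  If \<open>q = onorm Y \<ge> 1\<close> and \<open>a = 1 / q\<close>, then \<open>1 - a\<^sup>2 Y\<^sup>2 = (1 - a Y) (1 + a Y)\<close> is bounded below, which by
  \<open>\<parallel>u - a\<^sup>2 Y\<^sup>2 u\<parallel>\<^sup>2 \<le> \<parallel>u\<parallel>\<^sup>2 - a\<^sup>2 \<parallel>Y u\<parallel>\<^sup>2\<close> bounds the norm of \<open>Y\<close> strictly below \<open>q\<close>.
\<close>

lemma symmetric_strict_contraction:
  fixes Y :: "'a::complex_hilbert_space \<Rightarrow> 'a"
  assumes Y: "bounded_linear Y" and sym: "\<And>u v. cinner (Y u) v = cinner u (Y v)"
    and inv: "\<And>y. -1 \<le> y \<Longrightarrow> y \<le> 1 \<Longrightarrow> \<exists>M. \<forall>u. norm (Y u) \<le> M * norm (u - y *\<^sub>R Y u)"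
  shows "\<exists>q. 0 \<le> q \<and> q < 1 \<and> (\<forall>u. norm (Y u) \<le> q * norm u)"
proof -
  define q where "q = onorm Y"
  have q: "norm (Y u) \<le> q * norm u" for u unfolding q_def by (rule onorm[OF Y])
  have q0: "0 \<le> q" unfolding q_def by (rule onorm_pos_le[OF Y])
  have "q < 1"
  proof (rule ccontr)
    assume "\<not> q < 1"
    then have q1: "1 \<le> q" by simp
    define a where "a = 1 / q"
    have a: "0 < a" "a \<le> 1" "a * q = 1" using q1 by (auto simp: a_def)
    \<comment> \<open>The hypothesis bounds \<open>Y u\<close>; writing \<open>u\<close> as
      \<open>(u - y *\<^sub>R Y u) + y *\<^sub>R Y u\<close> turns it into a bound for
      \<open>u\<close> itself.\<close>
    have below: "\<exists>M\<ge>1. \<forall>u. norm u \<le> M * norm (u - y *\<^sub>R Y u)" if "\<bar>y\<bar> \<le> 1" for y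
    proof -
      obtain M where M: "\<forall>u. norm (Y u) \<le> M * norm (u - y *\<^sub>R Y u)"
        using inv[of y] \<open>\<bar>y\<bar> \<le> 1\<close> by (auto simp: abs_le_iff)
      have "norm u \<le> (1 + \<bar>M\<bar>) * norm (u - y *\<^sub>R Y u)" for u
      proof -
        have "norm u \<le> norm (u - y *\<^sub>R Y u) + \<bar>y\<bar> * norm (Y u)"
          using norm_triangle_ineq[of "u - y *\<^sub>R Y u" "y *\<^sub>R Y u"] by simp
        also have "\<bar>y\<bar> * norm (Y u) \<le> 1 * norm (Y u)" by (intro mult_right_mono that) simp
        also have "1 * norm (Y u) \<le> \<bar>M\<bar> * norm (u - y *\<^sub>R Y u)"
          using spec[OF M, of u] mult_right_mono[OF abs_ge_self[of M] norm_ge_zero[of "u - y *\<^sub>R Y u"]] by simp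
        finally show ?thesis by (simp add: algebra_simps)
      qed
      then show ?thesis by (intro exI[of _ "1 + \<bar>M\<bar>"]) auto
    qed
    obtain M1 where M1: "1 \<le> M1" "\<And>u. norm u \<le> M1 * norm (u - a *\<^sub>R Y u)" using below[of a] a by auto
    obtain M2 where M2: "1 \<le> M2" "\<And>u. norm u \<le> M2 * norm (u - (- a) *\<^sub>R Y u)" using below[of "- a"] a by auto
    define M where "M = M2 * M1"
    have M: "1 \<le> M" unfolding M_def using mult_mono[OF M2(1) M1(1)] M1 M2 by simp
    have lin: "linear Y" by (rule bounded_linear.linear[OF Y])
    have Mu: "norm u \<le> M * norm (u - (a * a) *\<^sub>R Y (Y u))" for u
    proof -
      let ?v = "u - (- a) *\<^sub>R Y u"
      have "norm u \<le> M2 * norm ?v" by (rule M2(2))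
      also have "\<dots> \<le> M2 * (M1 * norm (?v - a *\<^sub>R Y ?v))" by (intro mult_left_mono M1(2)) (use M2 in auto)
      also have "?v - a *\<^sub>R Y ?v = u - (a * a) *\<^sub>R Y (Y u)"
        by (simp add: linear_diff[OF lin] linear_add[OF lin] linear_scale[OF lin] algebra_simps)
      finally show ?thesis unfolding M_def by (simp add: mult.assoc)
    qed
    have "(norm (Y u))\<^sup>2 \<le> q\<^sup>2 * (1 - 1 / M\<^sup>2) * (norm u)\<^sup>2" for u
    proof -
      have YY: "Re (cinner (Y (Y u)) u) = (norm (Y u))\<^sup>2"
        using sym[of "Y u" u] cinner_self[of "Y u"] by simp
      have "(norm (u - (a * a) *\<^sub>R Y (Y u)))\<^sup>2 = Re (cinner (u - (a * a) *\<^sub>R Y (Y u)) (u - (a * a) *\<^sub>R Y (Y u)))"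
        by (simp add: cinner_self)
      also have "\<dots> = (norm u)\<^sup>2 - 2 * (a * a) * (norm (Y u))\<^sup>2 + (a * a) * (a * a) * (norm (Y (Y u)))\<^sup>2"
        using YY Re_cinner_commute[of u "Y (Y u)"]
        by (simp add: cinner_diff_left cinner_diff_right cinner_scaleR_left cinner_scaleR_right cinner_self[of u]
           cinner_self[of "Y (Y u)"] algebra_simps)
      \<comment> \<open>Because \<open>a * q = 1\<close>, the fourth-order term uses up exactly one
        of the two copies of \<open>(a * a) * (norm (Y u))\<^sup>2\<close> that are
        subtracted.\<close>
      also have "(a * a) * (a * a) * (norm (Y (Y u)))\<^sup>2 \<le> (a * a) * (a * a) * (q * norm (Y u))\<^sup>2"
        using a by (intro mult_left_mono power_mono q) auto
      also have "\<dots> = (a * q) * (a * q) * (a * a) * (norm (Y u))\<^sup>2" by (simp add: power2_eq_square)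
      also have "\<dots> = (a * a) * (norm (Y u))\<^sup>2" using a by simp
      finally have est: "(norm (u - (a * a) *\<^sub>R Y (Y u)))\<^sup>2 \<le> (norm u)\<^sup>2 - (a * a) * (norm (Y u))\<^sup>2" by simp
      have "(norm u)\<^sup>2 \<le> M\<^sup>2 * (norm (u - (a * a) *\<^sub>R Y (Y u)))\<^sup>2"
        using power_mono[OF Mu[of u] norm_ge_zero, of 2] by (simp add: power_mult_distrib)
      also have "\<dots> \<le> M\<^sup>2 * ((norm u)\<^sup>2 - (a * a) * (norm (Y u))\<^sup>2)" by (intro mult_left_mono est) simp
      finally have "(a * a) * (norm (Y u))\<^sup>2 \<le> (1 - 1 / M\<^sup>2) * (norm u)\<^sup>2"
        using M by (simp add: field_simps)
      then have "q\<^sup>2 * ((a * a) * (norm (Y u))\<^sup>2) \<le> q\<^sup>2 * ((1 - 1 / M\<^sup>2) * (norm u)\<^sup>2)" by (intro mult_left_mono) auto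
      moreover have "q\<^sup>2 * ((a * a) * (norm (Y u))\<^sup>2) = (norm (Y u))\<^sup>2"
      proof -
        have "q\<^sup>2 * ((a * a) * (norm (Y u))\<^sup>2) = (a * q) * (a * q) * (norm (Y u))\<^sup>2" by (simp add: power2_eq_square)
        then show ?thesis unfolding a(3) by simp
      qed
      ultimately show ?thesis by (simp only: mult.assoc)
    qed
    moreover define K where "K = q\<^sup>2 * (1 - 1 / M\<^sup>2)"
    ultimately have K: "(norm (Y u))\<^sup>2 \<le> K * (norm u)\<^sup>2" for u by blast
    have "1 / M\<^sup>2 \<le> 1" using M by simp
    then have K0: "0 \<le> K" unfolding K_def by simp
    have "norm (Y u) \<le> sqrt K * norm u" for u
      using real_sqrt_le_mono[OF K[of u]] by (simp add: real_sqrt_mult)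
    \<comment> \<open>\<open>q\<close> is the operator norm, hence the least bound, while
      \<open>K\<close> is strictly below \<open>q\<^sup>2\<close>.\<close>
    then have "q \<le> sqrt K" unfolding q_def using K0 by (intro onorm_bound) auto
    then have "q\<^sup>2 \<le> q\<^sup>2 * (1 - 1 / M\<^sup>2)"
      using q0 power_mono[of q "sqrt K" 2] K0 unfolding K_def[symmetric] by simp
    moreover have "0 < q\<^sup>2 * (1 / M\<^sup>2)" using q1 M by simp
    ultimately show False by (simp add: algebra_simps)
  qed
  with q q0 show ?thesis by blast
qed

section \<open>Diagonal operators of an orthogonal resolution\<close>

text \<open>Under an orthogonal resolution these operators multiply and take adjoints pointwise in
  the weights. The pencil is \<open>X\<close> minus such an operator, and shifts and scalings of the
  box become arithmetic of weights.\<close>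

definition diag_op :: "('d::finite \<Rightarrow> 'a \<Rightarrow> 'a) \<Rightarrow> ('d \<Rightarrow> complex) \<Rightarrow> 'a \<Rightarrow> 'a::complex_hilbert_space" where
  "diag_op P \<alpha> u = (\<Sum>r\<in>UNIV. scaleC (\<alpha> r) (P r u))"

lemma bounded_linear_scaleC: "bounded_linear (scaleC a :: 'a::complex_hilbert_space \<Rightarrow> 'a)"
  by (rule bounded_linear_intro[where K = "cmod a"])
    (auto simp: scaleC_add_right scaleC_scaleR norm_scaleC mult.commute)

context
  fixes P :: "'d::finite \<Rightarrow> 'a::complex_hilbert_space \<Rightarrow> 'a"
  assumes P: "orthogonal_resolution P"
begin

lemma resolution_linear: "bounded_linear (P r)" "P r (scaleC a x) = scaleC a (P r x)"
  using P unfolding orthogonal_resolution_def orthogonal_projection_def complex_linear_on_def by auto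

lemma resolution_adjoint: "cinner (P r x) y = cinner x (P r y)"
  using P unfolding orthogonal_resolution_def orthogonal_projection_def by auto

lemma resolution_sum: "(\<Sum>r\<in>UNIV. P r x) = x"
  using P unfolding orthogonal_resolution_def by auto

lemma resolution_comp: "P r (P s x) = (if r = s then P r x else 0)"
proof (cases "r = s")
  case True
  then show ?thesis using P unfolding orthogonal_resolution_def orthogonal_projection_def by auto
next
  case False
  then have "cinner (P r (P s x)) (P r (P s x)) = 0"
    using P unfolding orthogonal_resolution_def orthogonal_projection_def by metis
  then show ?thesis using False by (simp add: cinner_self_eq_zero_iff)
qed

lemma resolution_cinner: "cinner (P r x) y = cinner (P r x) (P r y)"
  using resolution_adjoint[of r "P r x" y] by (simp add: resolution_comp)

lemma diag_op_bounded_linear: "bounded_linear (diag_op P \<alpha>)"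
  unfolding diag_op_def
  by (intro bounded_linear_sum bounded_linear_compose[OF bounded_linear_scaleC] resolution_linear)

lemma diag_op_scaleC: "diag_op P \<alpha> (scaleC a x) = scaleC a (diag_op P \<alpha> x)"
  unfolding diag_op_def by (simp add: resolution_linear scaleC_sum_right scaleC_scaleC mult.commute)

lemma diag_op_sum: "diag_op P \<alpha> (\<Sum>i\<in>A. f i) = (\<Sum>i\<in>A. diag_op P \<alpha> (f i))"
  by (rule linear_sum[OF bounded_linear.linear[OF diag_op_bounded_linear]])

lemma diag_op_add: "diag_op P \<alpha> (x + y) = diag_op P \<alpha> x + diag_op P \<alpha> y"
  by (rule linear_add[OF bounded_linear.linear[OF diag_op_bounded_linear]])

lemma diag_op_diff: "diag_op P \<alpha> (x - y) = diag_op P \<alpha> x - diag_op P \<alpha> y"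
  by (rule linear_diff[OF bounded_linear.linear[OF diag_op_bounded_linear]])

lemma diag_op_coeff_sum: "diag_op P (\<lambda>r. \<Sum>k\<in>A. a k r) x = (\<Sum>k\<in>A. diag_op P (a k) x)"
  unfolding diag_op_def scaleC_sum_left by (rule sum.swap)

lemma diag_op_coeff_mult: "diag_op P (\<lambda>r. c * a r) x = scaleC c (diag_op P a x)"
  unfolding diag_op_def by (simp add: scaleC_sum_right scaleC_scaleC)

lemma diag_op_coeff_diff: "diag_op P (\<lambda>r. a r - b r) x = diag_op P a x - diag_op P b x"
  unfolding diag_op_def by (simp add: scaleC_diff_left sum_subtractf)

lemma diag_op_coeff_add: "diag_op P (\<lambda>r. a r + b r) x = diag_op P a x + diag_op P b x"
  unfolding diag_op_def by (simp add: scaleC_add_left sum.distrib)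

lemma resolution_diag_op: "P r (diag_op P \<alpha> x) = scaleC (\<alpha> r) (P r x)"
proof -
  have "P r (diag_op P \<alpha> x) = (\<Sum>s\<in>UNIV. scaleC (\<alpha> s) (P r (P s x)))"
    unfolding diag_op_def by (simp add: linear_sum[OF bounded_linear.linear[OF resolution_linear(1)]] resolution_linear(2))
  also have "\<dots> = (\<Sum>s\<in>UNIV. if s = r then scaleC (\<alpha> r) (P r x) else 0)"
    by (rule sum.cong) (auto simp: resolution_comp scaleC_zero_right)
  finally show ?thesis by simp
qed

lemma diag_op_comp: "diag_op P \<alpha> (diag_op P \<beta> x) = diag_op P (\<lambda>r. \<alpha> r * \<beta> r) x"
  unfolding diag_op_def[of P \<alpha>] resolution_diag_op by (simp add: diag_op_def scaleC_scaleC)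

lemma diag_op_one: "diag_op P (\<lambda>_. 1) x = x"
  unfolding diag_op_def by (simp add: scaleC_one resolution_sum)

lemma diag_op_adjoint: "cinner (diag_op P \<alpha> x) y = cinner x (diag_op P (\<lambda>r. cnj (\<alpha> r)) y)"
  unfolding diag_op_def
  by (simp add: cinner_sum_left cinner_sum_right cinner_scaleC_left cinner_scaleC_right resolution_adjoint)

text \<open>Pythagoras: the components \<open>P r x\<close> are mutually orthogonal and
  \<open>\<alpha> r\<close> scales each of them separately.\<close>

lemma norm_diag_op_power2: "(norm (diag_op P \<alpha> x))\<^sup>2 = (\<Sum>r\<in>UNIV. (cmod (\<alpha> r))\<^sup>2 * (norm (P r x))\<^sup>2)"
proof -
  have "complex_of_real ((norm (diag_op P \<alpha> x))\<^sup>2) = (\<Sum>r\<in>UNIV. \<alpha> r * cinner (P r x) (diag_op P \<alpha> x))"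
    unfolding cinner_self[symmetric] by (simp add: diag_op_def[of P \<alpha> x] cinner_sum_left cinner_scaleC_left)
  also have "\<dots> = (\<Sum>r\<in>UNIV. \<alpha> r * cnj (\<alpha> r) * cinner (P r x) (P r x))"
    by (subst resolution_cinner) (simp add: resolution_diag_op cinner_scaleC_right mult.assoc)
  also have "\<dots> = complex_of_real (\<Sum>r\<in>UNIV. (cmod (\<alpha> r))\<^sup>2 * (norm (P r x))\<^sup>2)"
    by (simp add: cinner_self complex_norm_square del: of_real_power)
  finally show ?thesis unfolding of_real_eq_iff .
qed

lemma norm_diag_op_le:
  assumes "\<And>r. cmod (\<alpha> r) \<le> 1"
  shows "norm (diag_op P \<alpha> x) \<le> norm x"
proof (rule power2_le_imp_le)
  have "(norm (diag_op P \<alpha> x))\<^sup>2 \<le> (norm (diag_op P (\<lambda>_. 1) x))\<^sup>2"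
    unfolding norm_diag_op_power2 using assms by (intro sum_mono mult_right_mono) (auto simp: power_le_one)
  then show "(norm (diag_op P \<alpha> x))\<^sup>2 \<le> (norm x)\<^sup>2" unfolding diag_op_one .
qed simp

end

section \<open>Block operators on the tensor product\<close>

text \<open>\<open>U \<otimes> 1\<close> preserves inner products when the columns of
  \<open>U\<close> are orthonormal. Below it serves for \<open>U\<close> and, after conjugation and
  transposition, for its adjoint.\<close>

lemma unitary_tensor_cinner:
  fixes a b :: "nat \<Rightarrow> 'a::complex_hilbert_space"
  assumes u: "\<And>k l. k < n \<Longrightarrow> l < n \<Longrightarrow> (\<Sum>i<n. cnj (u i k) * u i l) = (if k = l then 1 else 0)"
  shows "(\<Sum>i<n. cinner (\<Sum>k<n. scaleC (u i k) (a k)) (\<Sum>k<n. scaleC (u i k) (b k))) = (\<Sum>k<n. cinner (a k) (b k))"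
proof -
  have "(\<Sum>i<n. cinner (\<Sum>k<n. scaleC (u i k) (a k)) (\<Sum>k<n. scaleC (u i k) (b k)))
      = (\<Sum>i<n. \<Sum>l<n. \<Sum>k<n. (cnj (u i l) * u i k) * cinner (a k) (b l))"
    by (simp add: cinner_sum_left cinner_sum_right cinner_scaleC_left cinner_scaleC_right sum_distrib_left mult_ac)
  also have "\<dots> = (\<Sum>l<n. \<Sum>k<n. \<Sum>i<n. (cnj (u i l) * u i k) * cinner (a k) (b l))"
    by (rule trans[OF sum.swap]) (rule sum.cong[OF refl], rule sum.swap)
  also have "\<dots> = (\<Sum>l<n. \<Sum>k<n. if k = l then cinner (a k) (b l) else 0)"
    by (intro sum.cong refl) (simp add: sum_distrib_right[symmetric] u)
  also have "\<dots> = (\<Sum>k<n. cinner (a k) (b k))" by simp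
  finally show ?thesis .
qed

text \<open>The operator \<open>\<Sum>\<^sub>r (U diag(y\<^sub>1\<^sup>r, \<dots>, y\<^sub>n\<^sup>r) U\<^sup>*) \<otimes> P\<^sup>r\<close> as an \<open>n \<times> n\<close> block operator.\<close>

definition spectral_block ::
    "('d::finite \<Rightarrow> 'a \<Rightarrow> 'a) \<Rightarrow> nat \<Rightarrow> (nat \<Rightarrow> nat \<Rightarrow> complex) \<Rightarrow> (nat \<Rightarrow> 'd \<Rightarrow> real) \<Rightarrow> nat \<Rightarrow> nat \<Rightarrow> 'a \<Rightarrow> 'a::complex_hilbert_space" where
  "spectral_block P n u y i j = diag_op P (\<lambda>r. \<Sum>k<n. u i k * complex_of_real (y k r) * cnj (u j k))"

context
  fixes P :: "'d::finite \<Rightarrow> 'a::complex_hilbert_space \<Rightarrow> 'a"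
  assumes P: "orthogonal_resolution P"
begin

text \<open>Factorization into three maps: pass to the joint eigenbasis, apply the diagonal operator
  with weights \<open>y k\<close> in component \<open>k\<close>, and pass back.\<close>

lemma block_op_spectral_block:
  "block_op n (spectral_block P n u y) x i =
    (\<Sum>k<n. scaleC (u i k) (diag_op P (\<lambda>r. complex_of_real (y k r)) (\<Sum>j<n. scaleC (cnj (u j k)) (x j))))"
proof -
  have "block_op n (spectral_block P n u y) x i =
      (\<Sum>j<n. \<Sum>k<n. scaleC (u i k * cnj (u j k)) (diag_op P (\<lambda>r. complex_of_real (y k r)) (x j)))"
    unfolding block_op_def spectral_block_def diag_op_coeff_sum[OF P]
    by (simp add: diag_op_coeff_mult[OF P, symmetric] mult_ac)
  also have "\<dots> = (\<Sum>k<n. \<Sum>j<n. scaleC (u i k * cnj (u j k)) (diag_op P (\<lambda>r. complex_of_real (y k r)) (x j)))"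
    by (rule sum.swap)
  finally show ?thesis by (simp add: diag_op_sum[OF P] diag_op_scaleC[OF P] scaleC_sum_right scaleC_scaleC)
qed

lemma spectral_block_bounded_linear: "bounded_linear (spectral_block P n u y i j)"
  unfolding spectral_block_def by (rule diag_op_bounded_linear[OF P])

lemma spectral_block_adjoint: "cinner (spectral_block P n u y i j a) b = cinner a (spectral_block P n u y j i b)"
  unfolding spectral_block_def diag_op_adjoint[OF P] by (simp add: mult_ac)

lemma spectral_block_symmetric:
  "tinner n (block_op n (spectral_block P n u y) x) z = tinner n x (block_op n (spectral_block P n u y) z)"
proof -
  have "tinner n (block_op n (spectral_block P n u y) x) z = (\<Sum>i<n. \<Sum>j<n. Re (cinner (x j) (spectral_block P n u y j i (z i))))"
    unfolding tinner_def block_op_def by (simp add: cinner_sum_left spectral_block_adjoint)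
  also have "\<dots> = (\<Sum>j<n. \<Sum>i<n. Re (cinner (x j) (spectral_block P n u y j i (z i))))" by (rule sum.swap)
  finally show ?thesis unfolding tinner_def block_op_def by (simp add: cinner_sum_right)
qed

text \<open>In the factorization the two outer maps are isometric and each middle operator has
  weights of modulus at most 1.\<close>

lemma spectral_block_contraction:
  assumes col: "\<And>k l. k < n \<Longrightarrow> l < n \<Longrightarrow> (\<Sum>i<n. cnj (u i k) * u i l) = (if k = l then 1 else 0)"
    and row: "\<And>i j. i < n \<Longrightarrow> j < n \<Longrightarrow> (\<Sum>k<n. u i k * cnj (u j k)) = (if i = j then 1 else 0)"
    and y: "\<And>k r. k < n \<Longrightarrow> \<bar>y k r\<bar> \<le> 1"
  shows "tnorm n (block_op n (spectral_block P n u y) x) \<le> tnorm n x"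
proof (rule power2_le_imp_le)
  define x' where "x' k = (\<Sum>j<n. scaleC (cnj (u j k)) (x j))" for k
  have power2: "(tnorm n z)\<^sup>2 = Re (\<Sum>i<n. cinner (z i) (z i))" for z :: "nat \<Rightarrow> 'a"
    unfolding tnorm_power2 by (simp add: cinner_self del: of_real_power)
  have "(tnorm n (block_op n (spectral_block P n u y) x))\<^sup>2 = (tnorm n (\<lambda>k. diag_op P (\<lambda>r. complex_of_real (y k r)) (x' k)))\<^sup>2"
    unfolding power2 block_op_spectral_block x'_def[symmetric]
    by (subst unitary_tensor_cinner[OF col]) auto
  also have "\<dots> \<le> (tnorm n x')\<^sup>2"
    unfolding tnorm_power2 using y by (intro sum_mono power_mono norm_diag_op_le[OF P]) auto
  also have "(tnorm n x')\<^sup>2 = (tnorm n x)\<^sup>2"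
    unfolding power2 x'_def by (subst unitary_tensor_cinner[where u = "\<lambda>k j. cnj (u j k)"]) (auto simp: row mult_ac)
  finally show "(tnorm n (block_op n (spectral_block P n u y) x))\<^sup>2 \<le> (tnorm n x)\<^sup>2" .
qed (rule tnorm_nonneg)

end

section \<open>Resolvents on a box\<close>

lemma unitary_mat_sums:
  assumes U: "unitary_mat n U"
  shows "k < n \<Longrightarrow> l < n \<Longrightarrow> (\<Sum>i<n. cnj (U $$ (i, k)) * U $$ (i, l)) = (if k = l then 1 else 0)"
    "i < n \<Longrightarrow> j < n \<Longrightarrow> (\<Sum>k<n. U $$ (i, k) * cnj (U $$ (j, k))) = (if i = j then 1 else 0)"
proof -
  note u = unitary_matD[OF U]
  show "(\<Sum>i<n. cnj (U $$ (i, k)) * U $$ (i, l)) = (if k = l then 1 else 0)" if "k < n" "l < n"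
    using mat_mult_index[OF u(2,1) that] that unfolding u(3) by (simp add: mat_adjoint_index[OF u(1)])
  show "(\<Sum>k<n. U $$ (i, k) * cnj (U $$ (j, k))) = (if i = j then 1 else 0)" if "i < n" "j < n"
    using mat_mult_index[OF u(1,2) that] that unfolding u(4) by (simp add: mat_adjoint_index[OF u(1)])
qed

lemma unitary_diag_index:
  assumes U: "unitary_mat n U" and ij: "i < n" "j < n"
  shows "(U * mat_diag n f * mat_adjoint U) $$ (i, j) = (\<Sum>k<n. U $$ (i, k) * f k * cnj (U $$ (j, k)))"
proof -
  note u = unitary_matD[OF U]
  have UD: "U * mat_diag n f \<in> carrier_mat n n" using u by auto
  show ?thesis unfolding mat_mult_index[OF UD u(2) ij]
    by (rule sum.cong) (use ij u in \<open>auto simp: mat_diag_mult_right[OF u(1)] mat_adjoint_index[OF u(1)]\<close>)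
qed

lemma quadratic_form_index:
  fixes A :: "complex mat"
  assumes "A \<in> carrier_mat n n" "w \<in> carrier_vec n"
  shows "(A *\<^sub>v w) \<bullet>c w = (\<Sum>i<n. \<Sum>j<n. A $$ (i, j) * (w $ j * cnj (w $ i)))"
  using assms
  by (simp add: scalar_prod_def atLeast0LessThan conjugate_complex_def sum_distrib_right mult.assoc)

text \<open>The form of \<open>A \<otimes> 1\<close> at a tuple \<open>z\<close>, where
  \<open>A\<close> has eigenvalues \<open>f k\<close>. Each inner product on the right is a squared
  norm, so the sign of the form is governed by the eigenvalues.\<close>

lemma spectral_sum:
  fixes u :: "nat \<Rightarrow> nat \<Rightarrow> complex"
  shows "(\<Sum>i<n. \<Sum>j<n. (\<Sum>k<n. u i k * f k * cnj (u j k)) * cinner (z j) (z i)) =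
    (\<Sum>k<n. f k * cinner (\<Sum>j<n. scaleC (cnj (u j k)) (z j)) (\<Sum>j<n. scaleC (cnj (u j k)) (z j :: 'a::complex_hilbert_space)))"
proof -
  have "(\<Sum>i<n. \<Sum>j<n. (\<Sum>k<n. u i k * f k * cnj (u j k)) * cinner (z j) (z i)) =
      (\<Sum>i<n. \<Sum>j<n. \<Sum>k<n. u i k * f k * cnj (u j k) * cinner (z j) (z i))"
    by (simp add: sum_distrib_right)
  also have "\<dots> = (\<Sum>i<n. \<Sum>k<n. \<Sum>j<n. u i k * f k * cnj (u j k) * cinner (z j) (z i))"
    by (intro sum.cong refl sum.swap)
  also have "\<dots> = (\<Sum>k<n. \<Sum>i<n. \<Sum>j<n. u i k * f k * cnj (u j k) * cinner (z j) (z i))"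
    by (rule sum.swap)
  finally show ?thesis
    by (simp add: cinner_sum_left cinner_sum_right cinner_scaleC_left cinner_scaleC_right sum_distrib_left mult_ac)
qed

text \<open>\<open>\<omega>\<close> lists the coordinates of \<open>w\<close> in the eigenbasis
  given by the columns of \<open>U\<close>. This is the scalar counterpart of
  \<open>spectral_sum\<close>.\<close>

lemma unitary_diag_form:
  assumes U: "unitary_mat n U" and w: "w \<in> carrier_vec n"
  defines "\<omega> \<equiv> \<lambda>k. \<Sum>i<n. cnj (U $$ (i, k)) * w $ i"
  shows "((U * mat_diag n f * mat_adjoint U) *\<^sub>v w) \<bullet>c w = (\<Sum>k<n. f k * (\<omega> k * cnj (\<omega> k)))"
proof -
  note u = unitary_matD[OF U]
  have A: "U * mat_diag n f * mat_adjoint U \<in> carrier_mat n n" using u by auto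
  have "((U * mat_diag n f * mat_adjoint U) *\<^sub>v w) \<bullet>c w
      = (\<Sum>i<n. \<Sum>j<n. \<Sum>k<n. U $$ (i, k) * f k * cnj (U $$ (j, k)) * (w $ j * cnj (w $ i)))"
    unfolding quadratic_form_index[OF A w] by (intro sum.cong refl) (simp add: unitary_diag_index[OF U] sum_distrib_right)
  also have "\<dots> = (\<Sum>i<n. \<Sum>k<n. \<Sum>j<n. U $$ (i, k) * f k * cnj (U $$ (j, k)) * (w $ j * cnj (w $ i)))"
    by (intro sum.cong refl sum.swap)
  also have "\<dots> = (\<Sum>k<n. \<Sum>i<n. \<Sum>j<n. U $$ (i, k) * f k * cnj (U $$ (j, k)) * (w $ j * cnj (w $ i)))"
    by (rule sum.swap)
  also have "\<dots> = (\<Sum>k<n. f k * (cnj (\<omega> k) * \<omega> k))"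
    unfolding \<omega>_def by (simp add: cnj_sum sum_product sum_distrib_left mult_ac)
  finally show ?thesis by (simp add: mult.commute)
qed

lemma jointly_diagonalizes_eigenvalue:
  assumes D: "jointly_diagonalizes n S U x" and k: "k < n"
  shows "x k \<in> joint_eigenvalues n S"
proof -
  from D have U: "unitary_mat n U"
    and S: "\<And>r. S r = U * mat_diag n (\<lambda>i. complex_of_real (x i r)) * mat_adjoint U"
    unfolding jointly_diagonalizes_def by auto
  note u = unitary_matD[OF U]
  have c: "col U k \<in> carrier_vec n" using u k by auto
  have "col U k \<noteq> 0\<^sub>v n"
  proof
    assume *: "col U k = 0\<^sub>v n"
    have "U $$ (i, k) = 0" if "i < n" for i using arg_cong[OF *, of "\<lambda>v. v $ i"] that k u by auto
    then show False using unitary_mat_sums(1)[OF U k k] by simp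
  qed
  moreover have "S r *\<^sub>v col U k = complex_of_real (x k r) \<cdot>\<^sub>v col U k" for r
  proof -
    let ?D = "mat_diag n (\<lambda>i. complex_of_real (x i r))"
    have UD: "U * ?D \<in> carrier_mat n n" using u by auto
    have Sr: "S r \<in> carrier_mat n n" unfolding S using u by auto
    have "S r * U = U * ?D" unfolding S assoc_mult_mat[OF UD u(2,1)] u(3) by (rule right_mult_one_mat[OF UD])
    then have "S r *\<^sub>v col U k = col (U * ?D) k" using col_mult2[OF Sr u(1) k] by simp
    also have "\<dots> = complex_of_real (x k r) \<cdot>\<^sub>v col U k"
      unfolding mat_diag_mult_right[OF u(1)] by (rule eq_vecI) (use u k in \<open>auto simp: mult.commute\<close>)
    finally show ?thesis .
  qed
  ultimately show ?thesis unfolding joint_eigenvalues_def using c by blast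
qed

text \<open>Positivity of \<open>B - A\<close> on scalar vectors carries over to
  \<open>(B - A) \<otimes> 1\<close> on tuples of Hilbert space vectors, since diagonalizing
  \<open>B - A\<close> leaves nonnegative multiples of squared norms.\<close>

lemma mat_le_gram:
  fixes z :: "nat \<Rightarrow> 'a::complex_hilbert_space"
  assumes A: "self_adjoint_mat n A" and B: "self_adjoint_mat n B" and le: "mat_le n A B"
  shows "0 \<le> Re (\<Sum>i<n. \<Sum>j<n. (B $$ (i, j) - A $$ (i, j)) * cinner (z j) (z i))"
proof -
  from A B have c: "A \<in> carrier_mat n n" "B \<in> carrier_mat n n" and sa: "mat_adjoint A = A" "mat_adjoint B = B"
    unfolding self_adjoint_mat_def by auto
  define G where "G = B - A"
  have Gc: "G \<in> carrier_mat n n" unfolding G_def using c by auto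
  have "self_adjoint_mat n G" unfolding self_adjoint_mat_def
  proof (intro conjI Gc eq_matI)
    fix i j assume "i < dim_row G" "j < dim_col G"
    then have ij: "i < n" "j < n" using Gc by auto
    show "mat_adjoint G $$ (i, j) = G $$ (i, j)"
      unfolding mat_adjoint_index[OF Gc ij]
      using mat_adjoint_index[OF c(1) ij] mat_adjoint_index[OF c(2) ij] ij c by (simp add: sa G_def)
  qed (use Gc mat_adjoint_carrier[OF Gc] in auto)
  from self_adjoint_mat_diagonalization[OF this] obtain V m where
    V: "unitary_mat n V" and G: "G = V * mat_diag n (\<lambda>i. complex_of_real (m i)) * mat_adjoint V" by blast
  note v = unitary_matD[OF V]
  \<comment> \<open>The eigenvalue \<open>m k\<close> is the value of the quadratic form of
    \<open>G\<close> at the unit vector \<open>col V k\<close>.\<close>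
  have m: "0 \<le> m k" if k: "k < n" for k
  proof -
    have cV: "col V k \<in> carrier_vec n" using v k by auto
    have "(\<Sum>i<n. cnj (V $$ (i, l)) * col V k $ i) = (if l = k then 1 else 0)" if "l < n" for l
      unfolding unitary_mat_sums(1)[OF V that k, symmetric] by (rule sum.cong) (use v k in auto)
    then have "(G *\<^sub>v col V k) \<bullet>c col V k = (\<Sum>l<n. if l = k then complex_of_real (m k) else 0)"
      unfolding G unitary_diag_form[OF V cV] by (intro sum.cong refl) auto
    also have "\<dots> = complex_of_real (m k)" using k by simp
    finally show ?thesis using le cV unfolding mat_le_def G_def[symmetric] by (auto simp: less_eq_complex_def)
  qed
  have "(\<Sum>i<n. \<Sum>j<n. (B $$ (i, j) - A $$ (i, j)) * cinner (z j) (z i)) =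
      (\<Sum>i<n. \<Sum>j<n. (\<Sum>k<n. V $$ (i, k) * complex_of_real (m k) * cnj (V $$ (j, k))) * cinner (z j) (z i))"
    by (intro sum.cong refl) (use c in \<open>auto simp: unitary_diag_index[OF V, symmetric] G[symmetric] G_def\<close>)
  then show ?thesis unfolding spectral_sum using m by (auto simp: cinner_self intro!: sum_nonneg simp del: of_real_power)
qed

text \<open>Openness leaves room beyond the extreme points of \<open>A\<close>. Using it keeps
  \<open>e\<close> positive even if \<open>A\<close> is a single point, and positivity is what
  permits rescaling by \<open>e\<close> later.\<close>

lemma open_interval_enclosure:
  fixes I :: "real set"
  assumes I: "open I" "is_interval I" and A: "finite A" "A \<noteq> {}" "A \<subseteq> I"
  shows "\<exists>c e. 0 < e \<and> (\<forall>a\<in>A. \<bar>a - c\<bar> \<le> e) \<and> (\<forall>t. \<bar>t\<bar> \<le> 1 \<longrightarrow> c + t * e \<in> I)"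
proof -
  have mem: "Min A \<in> I" "Max A \<in> I" using A Min_in Max_in by auto
  obtain d1 where d1: "0 < d1" "cball (Min A) d1 \<subseteq> I" using I(1) mem(1) by (meson open_contains_cball)
  obtain d2 where d2: "0 < d2" "cball (Max A) d2 \<subseteq> I" using I(1) mem(2) by (meson open_contains_cball)
  \<comment> \<open>Midpoint and half-length of the enlarged interval from \<open>Min A - d1\<close>
    to \<open>Max A + d2\<close>.\<close>
  define c where "c = ((Min A - d1) + (Max A + d2)) / 2"
  define e where "e = ((Max A + d2) - (Min A - d1)) / 2"
  have mM: "Min A \<le> Max A" using A by (meson Max_in Min_le)
  have e: "0 < e" unfolding e_def using mM d1 d2 by simp
  have ends: "c - e \<in> I" "c + e \<in> I"
  proof -
    have "c - e = Min A - d1" "c + e = Max A + d2" unfolding c_def e_def by (simp_all add: field_simps)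
    then show "c - e \<in> I" "c + e \<in> I" using d1 d2 by (auto simp: dist_real_def subset_iff)
  qed
  have "c + t * e \<in> I" if "\<bar>t\<bar> \<le> 1" for t
  proof -
    have "\<bar>t * e\<bar> \<le> e" using that e by (simp add: abs_mult mult_left_le_one_le)
    then show ?thesis by (intro mem_is_interval_1_I[OF I(2) ends]) (simp_all add: abs_le_iff)
  qed
  moreover have "\<bar>a - c\<bar> \<le> e" if "a \<in> A" for a
  proof -
    have "Min A \<le> a" "a \<le> Max A" using that A by auto
    then show ?thesis unfolding c_def e_def using d1 d2 by (simp add: abs_le_iff field_simps)
  qed
  ultimately show ?thesis using e by blast
qed

section \<open>Resolvents of the pencil at real points\<close>

lemma mu_resolventD:
  assumes "z \<in> mu_resolvent D X P"
  shows "inv_into D (pencil X P z) u \<in> D"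
    "pencil X P z (inv_into D (pencil X P z) u) = u"
    "h \<in> D \<Longrightarrow> inv_into D (pencil X P z) (pencil X P z h) = h"
    "bounded_linear (inv_into D (pencil X P z))"
  using assms unfolding mu_resolvent_def has_bounded_inverse_def
  by (auto simp: bij_betw_def inv_into_into f_inv_into_f inv_into_f_f)

lemma pencil_diag_op: "pencil X P z h = X h - diag_op P z h"
  unfolding pencil_def diag_op_def ..

context
  fixes D :: "'a::complex_hilbert_space set" and X :: "'a \<Rightarrow> 'a" and P :: "'d::finite \<Rightarrow> 'a \<Rightarrow> 'a"
  assumes X: "self_adjoint_operator D X" and P: "orthogonal_resolution P"
begin

lemma self_adjoint_symmetric:
  assumes "h \<in> D" "k \<in> D"
  shows "cinner (X h) k = cinner h (X k)"
proof -
  have "(k, X k) \<in> adjoint_graph D X" using X assms unfolding self_adjoint_operator_def by blast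
  then show ?thesis using assms unfolding adjoint_graph_def by auto
qed

text \<open>Linearity of \<open>X\<close> is known only inside \<open>D\<close>, so membership of
  the partial sums has to be proved in the same induction.\<close>

lemma self_adjoint_lincomb:
  assumes "\<And>k. k \<in> A \<Longrightarrow> h k \<in> D"
  shows "(\<Sum>k\<in>A. scaleC (a k) (h k)) \<in> D \<and> X (\<Sum>k\<in>A. scaleC (a k) (h k)) = (\<Sum>k\<in>A. scaleC (a k) (X (h k)))"
proof -
  have sub: "complex_subspace D" and lin: "complex_linear_on D X"
    using X unfolding self_adjoint_operator_def densely_defined_operator_def by auto
  have zero: "0 \<in> D" "X 0 = 0"
  proof -
    show "0 \<in> D" using sub unfolding complex_subspace_def by auto
    then have "X (scaleC 0 0) = scaleC 0 (X 0)" using lin unfolding complex_linear_on_def by blast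
    then show "X 0 = 0" by (simp add: scaleC_zero_left)
  qed
  show ?thesis using assms
  proof (induction A rule: infinite_finite_induct)
    case (insert k A)
    then have IH: "(\<Sum>k\<in>A. scaleC (a k) (h k)) \<in> D" "X (\<Sum>k\<in>A. scaleC (a k) (h k)) = (\<Sum>k\<in>A. scaleC (a k) (X (h k)))"
      and k: "scaleC (a k) (h k) \<in> D" "X (scaleC (a k) (h k)) = scaleC (a k) (X (h k))"
      using sub lin unfolding complex_subspace_def complex_linear_on_def by auto
    then have "scaleC (a k) (h k) + (\<Sum>k\<in>A. scaleC (a k) (h k)) \<in> D"
      using sub unfolding complex_subspace_def by blast
    moreover have "X (scaleC (a k) (h k) + (\<Sum>k\<in>A. scaleC (a k) (h k))) = X (scaleC (a k) (h k)) + X (\<Sum>k\<in>A. scaleC (a k) (h k))"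
      using lin IH(1) k(1) unfolding complex_linear_on_def by blast
    ultimately show ?case using insert.hyps IH k by simp
  qed (simp_all add: zero)
qed

text \<open>At a real point the pencil is symmetric on \<open>D\<close>; inserting it in front of
  \<open>R w\<close> and moving it to \<open>R u\<close> transfers the symmetry to its
  inverse.\<close>

lemma resolvent_symmetric:
  assumes z: "complexify x \<in> mu_resolvent D X P"
  defines "R \<equiv> inv_into D (pencil X P (complexify x))"
  shows "cinner (R u) w = cinner u (R w)"
proof -
  note R = mu_resolventD[OF z, folded R_def]
  have sa: "cinner (diag_op P (complexify x) a) b = cinner a (diag_op P (complexify x) b)" for a b
    unfolding diag_op_adjoint[OF P] complexify_def by simp
  have "cinner (R u) w = cinner (R u) (pencil X P (complexify x) (R w))" unfolding R(2) ..
  also have "\<dots> = cinner (pencil X P (complexify x) (R u)) (R w)"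
    unfolding pencil_diag_op cinner_diff_left cinner_diff_right sa
    using self_adjoint_symmetric[OF R(1) R(1)] by simp
  finally show ?thesis unfolding R(2) .
qed

context
  fixes c e :: "'d \<Rightarrow> real"
  assumes e: "\<And>r. 0 < e r"
    and box: "\<And>t. \<bar>t\<bar> \<le> 1 \<Longrightarrow> complexify (\<lambda>r. c r + t * e r) \<in> mu_resolvent D X P"
begin

text \<open>
  Conjugating \<open>(X - \<Sum>\<^sub>r c\<^sub>r P\<^sup>r)\<^sup>-\<^sup>1\<close> by \<open>\<Sum>\<^sub>r \<surd>e\<^sub>r P\<^sup>r\<close> turns the box with centre \<open>c\<close> and half-widths \<open>e\<close>
  into the cube \<open>[-1, 1]\<^sup>d\<close>.
\<close>

definition scaled_resolvent :: "'a \<Rightarrow> 'a" where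
  "scaled_resolvent u = diag_op P (\<lambda>r. complex_of_real (sqrt (e r)))
     (inv_into D (pencil X P (complexify c)) (diag_op P (\<lambda>r. complex_of_real (sqrt (e r))) u))"

lemma centre_resolvent: "complexify c \<in> mu_resolvent D X P"
  using box[of 0] by simp

lemma scaled_resolvent_bounded_linear: "bounded_linear scaled_resolvent"
  unfolding scaled_resolvent_def
  by (intro bounded_linear_compose[OF diag_op_bounded_linear[OF P]]
      bounded_linear_compose[OF mu_resolventD(4)[OF centre_resolvent]] diag_op_bounded_linear[OF P])

lemma scaled_resolvent_symmetric: "cinner (scaled_resolvent u) w = cinner u (scaled_resolvent w)"
  unfolding scaled_resolvent_def diag_op_adjoint[OF P] resolvent_symmetric[OF centre_resolvent] by simp

text \<open>Invertibility at the endpoints \<open>t = 1\<close> and \<open>t = -1\<close> is what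
  makes the contraction strict. The bound required for each \<open>t\<close> comes from the bounded
  operator \<open>?H ?Rz ?H\<close>, which sends \<open>u - t *\<^sub>R scaled_resolvent u\<close>
  to \<open>scaled_resolvent u\<close>.\<close>

lemma scaled_resolvent_contraction: "\<exists>q. 0 \<le> q \<and> q < 1 \<and> (\<forall>u. norm (scaled_resolvent u) \<le> q * norm u)"
proof (rule symmetric_strict_contraction[OF scaled_resolvent_bounded_linear scaled_resolvent_symmetric])
  fix t :: real assume "-1 \<le> t" "t \<le> 1"
  then have z: "complexify (\<lambda>r. c r + t * e r) \<in> mu_resolvent D X P" using box[of t] by simp
  let ?H = "diag_op P (\<lambda>r. complex_of_real (sqrt (e r)))"
  let ?R = "inv_into D (pencil X P (complexify c))"
  let ?Rz = "inv_into D (pencil X P (complexify (\<lambda>r. c r + t * e r)))"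
  note R = mu_resolventD[OF centre_resolvent] and Rz = mu_resolventD[OF z]
  have HH: "?H (?H a) = diag_op P (\<lambda>r. complex_of_real (e r)) a" for a
    unfolding diag_op_comp[OF P] using e by (simp add: less_imp_le flip: of_real_mult)
  have eq: "scaled_resolvent u = ?H (?Rz (?H (u - t *\<^sub>R scaled_resolvent u)))" for u
  proof -
    \<comment> \<open>The pencils at \<open>c\<close> and \<open>c + t e\<close> differ on
      \<open>w\<close> by \<open>t\<close> times \<open>?H (?H w)\<close>, and \<open>?H w\<close>
      is \<open>scaled_resolvent u\<close>.\<close>
    define w where "w = ?R (?H u)"
    have w: "w \<in> D" "X w - diag_op P (complexify c) w = ?H u"
      using R(1,2) unfolding w_def pencil_diag_op by auto
    have "pencil X P (complexify (\<lambda>r. c r + t * e r)) w = ?H u - diag_op P (\<lambda>r. complex_of_real t * complex_of_real (e r)) w"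
      unfolding pencil_diag_op complexify_def w(2)[symmetric] by (simp add: diag_op_coeff_add[OF P] algebra_simps)
    also have "\<dots> = ?H (u - t *\<^sub>R ?H w)"
      unfolding diag_op_diff[OF P] scaleR_eq_scaleC diag_op_scaleC[OF P] HH diag_op_coeff_mult[OF P] ..
    finally show ?thesis using Rz(3)[OF w(1)] unfolding scaled_resolvent_def w_def[symmetric] by simp
  qed
  have "bounded_linear (\<lambda>u. ?H (?Rz (?H u)))"
    by (intro bounded_linear_compose[OF diag_op_bounded_linear[OF P]] bounded_linear_compose[OF Rz(4)] diag_op_bounded_linear[OF P])
  from bounded_linear.bounded[OF this] obtain M where "\<And>u. norm (?H (?Rz (?H u))) \<le> norm u * M" by blast
  then show "\<exists>M. \<forall>u. norm (scaled_resolvent u) \<le> M * norm (u - t *\<^sub>R scaled_resolvent u)"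
    using eq by (metis mult.commute)
qed

text \<open>The vector \<open>v \<otimes> w\<close> splits along the joint eigenbasis into
  components \<open>\<omega> k v\<close>. Each is solved by the resolvent at the joint eigenvalue
  \<open>x k\<close>, which is where values of the function at joint eigenvalues come from. The
  scaling by \<open>sqrt (e r)\<close> is offset by its inverse in \<open>\<xi>\<close>.\<close>

lemma spectral_block_solution:
  fixes v :: 'a and w :: "complex vec"
  assumes U: "unitary_mat n U"
    and x: "\<And>k. k < n \<Longrightarrow> complexify (x k) \<in> mu_resolvent D X P"
    and w: "w \<in> carrier_vec n"
  defines "y \<equiv> \<lambda>k r. (x k r - c r) / e r"
    and "\<omega> \<equiv> \<lambda>k. \<Sum>i<n. cnj (U $$ (i, k)) * w $ i"
    and "\<xi> \<equiv> \<lambda>i. diag_op P (\<lambda>r. complex_of_real (1 / sqrt (e r))) (scaleC (w $ i) v)"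
  shows "\<exists>g. (\<forall>i<n. g i = scaled_resolvent (\<xi> i + block_op n (spectral_block P n (\<lambda>i k. U $$ (i, k)) y) g i)) \<and>
    tinner n g \<xi> = Re (\<Sum>k<n. cinner (inv_into D (pencil X P (complexify (x k))) v) v * (\<omega> k * cnj (\<omega> k)))"
proof -
  let ?H = "diag_op P (\<lambda>r. complex_of_real (sqrt (e r)))"
  let ?R = "inv_into D (pencil X P (complexify c))"
  let ?K = "diag_op P (\<lambda>r. complex_of_real (1 / sqrt (e r)))"
  define p where "p k = inv_into D (pencil X P (complexify (x k))) v" for k
  have p: "p k \<in> D" "X (p k) = v + diag_op P (complexify (x k)) (p k)" if "k < n" for k
    using mu_resolventD(1,2)[OF x[OF that], of v] unfolding p_def[symmetric] pencil_diag_op by (auto simp: algebra_simps)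
  \<comment> \<open>The unscaled solution, reassembled from the eigencomponents; it lies in
    \<open>D\<close> coordinatewise.\<close>
  define h where "h i = (\<Sum>k<n. scaleC (U $$ (i, k) * \<omega> k) (p k))" for i
  define g where "g i = ?H (h i)" for i
  have sqrt_ne: "sqrt (e r) \<noteq> 0" for r using e[of r] by simp
  have HK: "?H (?K a) = a" "?K (?H a) = a" for a
    unfolding diag_op_comp[OF P] using sqrt_ne by (simp_all add: diag_op_one[OF P] flip: of_real_mult)
  \<comment> \<open>The scalings in \<open>g\<close> and \<open>\<xi>\<close> cancel, so
    \<open>tinner n g \<xi>\<close> is the form of the unscaled resolvent at
    \<open>v \<otimes> w\<close>.\<close>
  have K_adj: "cinner (?H a) (?K b) = cinner a b" for a b
    unfolding diag_op_adjoint[OF P] using HK by simp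
  have hD: "h i \<in> D" and Xh0: "X (h i) = (\<Sum>k<n. scaleC (U $$ (i, k) * \<omega> k) (X (p k)))" for i
    using self_adjoint_lincomb[of "{..<n}" p "\<lambda>k. U $$ (i, k) * \<omega> k"] p(1) unfolding h_def by auto
  have Xh: "X (h i) = (\<Sum>k<n. scaleC (U $$ (i, k) * \<omega> k) (v + diag_op P (complexify (x k)) (p k)))" for i
    unfolding Xh0 by (rule sum.cong) (simp_all add: p(2))
  have w_sum: "(\<Sum>k<n. U $$ (i, k) * \<omega> k) = w $ i" if i: "i < n" for i
  proof -
    have "(\<Sum>k<n. U $$ (i, k) * \<omega> k) = (\<Sum>k<n. \<Sum>j<n. U $$ (i, k) * cnj (U $$ (j, k)) * w $ j)"
      unfolding \<omega>_def by (simp add: sum_distrib_left mult.assoc)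
    also have "\<dots> = (\<Sum>j<n. \<Sum>k<n. U $$ (i, k) * cnj (U $$ (j, k)) * w $ j)" by (rule sum.swap)
    also have "\<dots> = (\<Sum>j<n. if j = i then w $ j else 0)"
      by (intro sum.cong refl) (auto simp: unitary_mat_sums(2)[OF U i] simp flip: sum_distrib_right)
    also have "\<dots> = w $ i" using i by simp
    finally show ?thesis .
  qed
  have h_hat: "(\<Sum>j<n. scaleC (cnj (U $$ (j, k))) (h j)) = scaleC (\<omega> k) (p k)" if k: "k < n" for k
  proof -
    have "(\<Sum>j<n. scaleC (cnj (U $$ (j, k))) (h j)) = (\<Sum>j<n. \<Sum>l<n. scaleC (cnj (U $$ (j, k)) * U $$ (j, l)) (scaleC (\<omega> l) (p l)))"
      unfolding h_def by (simp add: scaleC_sum_right scaleC_scaleC mult.assoc)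
    also have "\<dots> = (\<Sum>l<n. \<Sum>j<n. scaleC (cnj (U $$ (j, k)) * U $$ (j, l)) (scaleC (\<omega> l) (p l)))" by (rule sum.swap)
    also have "\<dots> = (\<Sum>l<n. if l = k then scaleC (\<omega> l) (p l) else 0)"
      by (intro sum.cong refl)
        (auto simp: unitary_mat_sums(1)[OF U k] scaleC_one scaleC_zero_left simp flip: scaleC_sum_left)
    also have "\<dots> = scaleC (\<omega> k) (p k)" using k by simp
    finally show ?thesis .
  qed
  have "g i = scaled_resolvent (\<xi> i + block_op n (spectral_block P n (\<lambda>i k. U $$ (i, k)) y) g i)" if i: "i < n" for i
  proof -
    have "(\<Sum>j<n. scaleC (cnj (U $$ (j, k))) (g j)) = ?H (\<Sum>j<n. scaleC (cnj (U $$ (j, k))) (h j))" for k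
      unfolding g_def by (simp add: diag_op_sum[OF P] diag_op_scaleC[OF P])
    then have block: "block_op n (spectral_block P n (\<lambda>i k. U $$ (i, k)) y) g i =
        (\<Sum>k<n. scaleC (U $$ (i, k)) (diag_op P (\<lambda>r. complex_of_real (y k r)) (?H (scaleC (\<omega> k) (p k)))))"
      unfolding block_op_spectral_block[OF P] by (simp add: h_hat)
    \<comment> \<open>Placed between the two square-root factors, the normalized weight returns the
      displacement of \<open>x k\<close> from the centre.\<close>
    have coeff: "(\<lambda>r. complex_of_real (sqrt (e r)) * (complex_of_real (y k r) * complex_of_real (sqrt (e r)))) =
        (\<lambda>r. complexify (x k) r - complexify c r)" for k
    proof
      fix r
      have "sqrt (e r) * (y k r * sqrt (e r)) = x k r - c r"
        unfolding y_def using e[of r] by (simp add: field_simps)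
      then show "complex_of_real (sqrt (e r)) * (complex_of_real (y k r) * complex_of_real (sqrt (e r))) =
          complexify (x k) r - complexify c r"
        unfolding complexify_def by (simp flip: of_real_mult of_real_diff)
    qed
    have Hblock: "?H (block_op n (spectral_block P n (\<lambda>i k. U $$ (i, k)) y) g i) =
        (\<Sum>k<n. scaleC (U $$ (i, k) * \<omega> k) (diag_op P (complexify (x k)) (p k) - diag_op P (complexify c) (p k)))"
      unfolding block diag_op_sum[OF P] diag_op_scaleC[OF P] diag_op_comp[OF P] coeff
      by (simp add: diag_op_coeff_diff[OF P] scaleC_scaleC)
    have "pencil X P (complexify c) (h i) = scaleC (w $ i) v + ?H (block_op n (spectral_block P n (\<lambda>i k. U $$ (i, k)) y) g i)"
      unfolding pencil_diag_op Xh Hblock w_sum[OF i, symmetric]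
      unfolding h_def diag_op_sum[OF P] diag_op_scaleC[OF P]
      by (simp add: scaleC_sum_left scaleC_add_right scaleC_diff_right sum.distrib sum_subtractf)
    also have "\<dots> = ?H (\<xi> i + block_op n (spectral_block P n (\<lambda>i k. U $$ (i, k)) y) g i)"
      unfolding diag_op_add[OF P] \<xi>_def HK ..
    finally show ?thesis
      unfolding scaled_resolvent_def g_def using mu_resolventD(3)[OF centre_resolvent hD[of i]] by simp
  qed
  moreover have "tinner n g \<xi> = Re (\<Sum>k<n. cinner (p k) v * (\<omega> k * cnj (\<omega> k)))"
  proof -
    have "tinner n g \<xi> = Re (\<Sum>i<n. \<Sum>k<n. U $$ (i, k) * cnj (w $ i) * (\<omega> k * cinner (p k) v))"
      unfolding tinner_def g_def \<xi>_def K_adj h_def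
      by (simp add: cinner_sum_left cinner_scaleC_left cinner_scaleC_right sum_distrib_left mult_ac)
    also have "(\<Sum>i<n. \<Sum>k<n. U $$ (i, k) * cnj (w $ i) * (\<omega> k * cinner (p k) v)) =
        (\<Sum>k<n. \<Sum>i<n. U $$ (i, k) * cnj (w $ i) * (\<omega> k * cinner (p k) v))" by (rule sum.swap)
    also have "\<dots> = (\<Sum>k<n. cnj (\<omega> k) * (\<omega> k * cinner (p k) v))"
      unfolding \<omega>_def by (simp add: cnj_sum sum_distrib_right)
    finally show ?thesis by (simp add: mult_ac)
  qed
  ultimately show ?thesis unfolding p_def by blast
qed

end

end


section \<open>Comparison of the two values of the joint calculus\<close>

lemma joint_calculus_le_on_box:
  fixes D :: "'a::complex_hilbert_space set" and P :: "'d::finite \<Rightarrow> 'a \<Rightarrow> 'a" and v :: 'a and C :: real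
  assumes X: "self_adjoint_operator D X" and P: "orthogonal_resolution P"
    and box: "open_box E" and E: "complexify ` E \<subseteq> mu_resolvent D X P"
    and S: "S \<in> CSAM n" "joint_eigenvalues n S \<subseteq> E" and T: "T \<in> CSAM n" "joint_eigenvalues n T \<subseteq> E"
    and le: "\<And>r. mat_le n (S r) (T r)"
    and f: "\<And>x. x \<in> E \<Longrightarrow> complex_of_real (f x) =
      complex_of_real C + cinner (inv_into D (pencil X P (complexify x)) v) v"
  shows "mat_le n (joint_calculus n f S) (joint_calculus n f T)"
\<comment> \<open>The enclosing intervals are built around the coordinates of the joint eigenvalues,
  which form an empty set when \<open>n = 0\<close>.\<close>
proof (cases "n = 0")
  case True
  then show ?thesis unfolding mat_le_def by (auto simp: scalar_prod_def)
next
  case False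
  obtain U x where Ux: "jointly_diagonalizes n S U x" by (rule CSAM_joint_diagonalization[OF S(1)])
  obtain V y where Vy: "jointly_diagonalizes n T V y" by (rule CSAM_joint_diagonalization[OF T(1)])
  from Ux Vy have U: "unitary_mat n U" and V: "unitary_mat n V"
    and Sx: "\<And>r. S r = U * mat_diag n (\<lambda>i. complex_of_real (x i r)) * mat_adjoint U"
    and Ty: "\<And>r. T r = V * mat_diag n (\<lambda>i. complex_of_real (y i r)) * mat_adjoint V"
    unfolding jointly_diagonalizes_def by auto
  note u = unitary_matD[OF U] and v' = unitary_matD[OF V]
  have xE: "x k \<in> E" and yE: "y k \<in> E" if "k < n" for k
    using jointly_diagonalizes_eigenvalue[OF Ux that] jointly_diagonalizes_eigenvalue[OF Vy that] S T by auto
  have xR: "complexify (x k) \<in> mu_resolvent D X P" and yR: "complexify (y k) \<in> mu_resolvent D X P" if "k < n" for k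
    using xE[OF that] yE[OF that] E by auto
  from box obtain I where "(\<forall>r. open (I r) \<and> is_interval (I r)) \<and> E = {x. \<forall>r. x r \<in> I r}"
    unfolding open_box_def by (rule exE)
  then have I: "\<And>r. open (I r)" "\<And>r. is_interval (I r)" and EI: "E = {x. \<forall>r. x r \<in> I r}" by simp_all
  have "\<exists>c e. 0 < e \<and> (\<forall>a\<in>(\<lambda>k. x k r) ` {..<n} \<union> (\<lambda>k. y k r) ` {..<n}. \<bar>a - c\<bar> \<le> e) \<and>
      (\<forall>t. \<bar>t\<bar> \<le> 1 \<longrightarrow> c + t * e \<in> I r)" for r
    by (rule open_interval_enclosure[OF I]) (use xE yE EI False in auto)
  then obtain c e where e: "\<And>r. 0 < e r"
    and near: "\<And>r. \<forall>a\<in>(\<lambda>k. x k r) ` {..<n} \<union> (\<lambda>k. y k r) ` {..<n}. \<bar>a - c r\<bar> \<le> e r"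
    and inI: "\<And>r t. \<bar>t\<bar> \<le> 1 \<Longrightarrow> c r + t * e r \<in> I r"
    by metis
  \<comment> \<open>The same \<open>t\<close> is taken in every coordinate; the product form of
    \<open>E\<close> puts the resulting point in \<open>E\<close>.\<close>
  have cube: "complexify (\<lambda>r. c r + t * e r) \<in> mu_resolvent D X P" if "\<bar>t\<bar> \<le> 1" for t
    using E inI[OF that] unfolding EI by auto
  let ?x = "\<lambda>k r. (x k r - c r) / e r" and ?y = "\<lambda>k r. (y k r - c r) / e r"
  let ?BS = "spectral_block P n (\<lambda>i k. U $$ (i, k)) ?x" and ?BT = "spectral_block P n (\<lambda>i k. V $$ (i, k)) ?y"
  have x1: "\<bar>?x k r\<bar> \<le> 1" and y1: "\<bar>?y k r\<bar> \<le> 1" if "k < n" for k r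
    using near[of r] e[of r] that by (auto simp: abs_divide)
  have coeff: "(\<Sum>k<n. W $$ (i, k) * complex_of_real ((z k r - c r) / e r) * cnj (W $$ (j, k))) =
      ((W * mat_diag n (\<lambda>i. complex_of_real (z i r)) * mat_adjoint W) $$ (i, j) - complex_of_real (c r) * (if i = j then 1 else 0))
        / complex_of_real (e r)"
    if "unitary_mat n W" "i < n" "j < n" for W z r i j
    unfolding unitary_diag_index[OF that] unitary_mat_sums(2)[OF that, symmetric]
    by (simp add: sum_distrib_left sum_subtractf[symmetric] sum_divide_distrib algebra_simps diff_divide_distrib)
  \<comment> \<open>Both blocks use the same centre, so the shifts cancel. What remains is one Gram
    form of \<open>T r - S r\<close> on the vectors \<open>P r (g i)\<close> for each
    \<open>r\<close>, divided by the positive number \<open>e r\<close>.\<close>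
  have form: "tinner n (block_op n ?BT g) g - tinner n (block_op n ?BS g) g =
      (\<Sum>r\<in>UNIV. Re (\<Sum>i<n. \<Sum>j<n. (T r $$ (i, j) - S r $$ (i, j)) * cinner (P r (g j)) (P r (g i))) / e r)" for g
  proof -
    have entry: "cinner (?BT i j a) b - cinner (?BS i j a) b =
        (\<Sum>r\<in>UNIV. (T r $$ (i, j) - S r $$ (i, j)) * cinner (P r a) (P r b) / complex_of_real (e r))"
      if "i < n" "j < n" for i j a b
      unfolding spectral_block_def coeff[OF U that] coeff[OF V that] Sx[symmetric] Ty[symmetric]
        cinner_diff_left[symmetric] diag_op_coeff_diff[OF P, symmetric]
      unfolding diag_op_def cinner_sum_left cinner_scaleC_left resolution_cinner[OF P, of _ a b]
      by (intro sum.cong refl) (simp add: diff_divide_distrib algebra_simps)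
    have "tinner n (block_op n ?BT g) g - tinner n (block_op n ?BS g) g =
        Re (\<Sum>i<n. \<Sum>j<n. cinner (?BT i j (g j)) (g i) - cinner (?BS i j (g j)) (g i))"
      unfolding tinner_def block_op_def by (simp add: cinner_sum_left sum_subtractf)
    also have "(\<Sum>i<n. \<Sum>j<n. cinner (?BT i j (g j)) (g i) - cinner (?BS i j (g j)) (g i)) =
        (\<Sum>i<n. \<Sum>j<n. \<Sum>r\<in>UNIV. (T r $$ (i, j) - S r $$ (i, j)) * cinner (P r (g j)) (P r (g i)) / complex_of_real (e r))"
      by (intro sum.cong refl entry) auto
    also have "\<dots> = (\<Sum>i<n. \<Sum>r\<in>UNIV. \<Sum>j<n. (T r $$ (i, j) - S r $$ (i, j)) * cinner (P r (g j)) (P r (g i)) / complex_of_real (e r))"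
      by (intro sum.cong refl sum.swap)
    also have "\<dots> = (\<Sum>r\<in>UNIV. \<Sum>i<n. \<Sum>j<n. (T r $$ (i, j) - S r $$ (i, j)) * cinner (P r (g j)) (P r (g i)) / complex_of_real (e r))"
      by (rule sum.swap)
    finally show ?thesis by (simp add: sum_divide_distrib[symmetric])
  qed
  have order: "tinner n (block_op n ?BS g) g \<le> tinner n (block_op n ?BT g) g" for g
  proof -
    have "0 \<le> (\<Sum>r\<in>UNIV. Re (\<Sum>i<n. \<Sum>j<n. (T r $$ (i, j) - S r $$ (i, j)) * cinner (P r (g j)) (P r (g i))) / e r)"
      using mat_le_gram[OF CSAM_D(1)[OF S(1)] CSAM_D(1)[OF T(1)] le] e
      by (intro sum_nonneg divide_nonneg_nonneg) (auto simp: less_imp_le)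
    then show ?thesis unfolding form[symmetric] by simp
  qed
  let ?Y = "scaled_resolvent D X P c e"
  obtain q where q: "0 \<le> q" "q < 1" "\<And>u. norm (?Y u) \<le> q * norm u"
    using scaled_resolvent_contraction[OF X P e cube] by blast
  have calc: "joint_calculus n f S = U * mat_diag n (\<lambda>i. complex_of_real (f (x i))) * mat_adjoint U"
    "joint_calculus n f T = V * mat_diag n (\<lambda>i. complex_of_real (f (y i))) * mat_adjoint V"
    by (rule joint_calculus_eq[OF Ux] joint_calculus_eq[OF Vy])+
  have carrier: "joint_calculus n f S \<in> carrier_mat n n" "joint_calculus n f T \<in> carrier_mat n n"
    unfolding calc using u v' by auto
  show ?thesis unfolding mat_le_def
  proof
    fix w :: "complex vec" assume w: "w \<in> carrier_vec n"
    let ?\<omega> = "\<lambda>W k. \<Sum>i<n. cnj (W $$ (i, k)) * w $ i"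
    let ?\<xi> = "\<lambda>i. diag_op P (\<lambda>r. complex_of_real (1 / sqrt (e r))) (scaleC (w $ i) v)"
    let ?F = "\<lambda>z. inv_into D (pencil X P (complexify z)) v"
    from spectral_block_solution[where x = x and v = v, OF X P e cube U xR w] obtain g where
      "(\<forall>i<n. g i = ?Y (?\<xi> i + block_op n ?BS g i)) \<and>
       tinner n g ?\<xi> = Re (\<Sum>k<n. cinner (?F (x k)) v * (?\<omega> U k * cnj (?\<omega> U k)))"
      by (rule exE)
    then have g: "\<And>i. i < n \<Longrightarrow> g i = ?Y (?\<xi> i + block_op n ?BS g i)"
      and gS: "tinner n g ?\<xi> = Re (\<Sum>k<n. cinner (?F (x k)) v * (?\<omega> U k * cnj (?\<omega> U k)))"
      by simp_all
    from spectral_block_solution[where x = y and v = v, OF X P e cube V yR w] obtain h where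
      "(\<forall>i<n. h i = ?Y (?\<xi> i + block_op n ?BT h i)) \<and>
       tinner n h ?\<xi> = Re (\<Sum>k<n. cinner (?F (y k)) v * (?\<omega> V k * cnj (?\<omega> V k)))"
      by (rule exE)
    then have h: "\<And>i. i < n \<Longrightarrow> h i = ?Y (?\<xi> i + block_op n ?BT h i)"
      and hT: "tinner n h ?\<xi> = Re (\<Sum>k<n. cinner (?F (y k)) v * (?\<omega> V k * cnj (?\<omega> V k)))"
      by simp_all
    have le_gh: "tinner n g ?\<xi> \<le> tinner n h ?\<xi>"
      by (rule resolvent_form_mono[OF scaled_resolvent_bounded_linear[OF X P e cube] scaled_resolvent_symmetric[OF X P e cube]
            q(3,1,2) spectral_block_bounded_linear[OF P] spectral_block_bounded_linear[OF P]
            spectral_block_contraction[OF P unitary_mat_sums(1)[OF U] unitary_mat_sums(2)[OF U] x1]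
            spectral_block_contraction[OF P unitary_mat_sums(1)[OF V] unitary_mat_sums(2)[OF V] y1]
            spectral_block_symmetric[OF P] spectral_block_symmetric[OF P] order g h])
    have norm_\<omega>: "(\<Sum>k<n. ?\<omega> W k * cnj (?\<omega> W k)) = w \<bullet>c w" if W: "unitary_mat n W" for W
      using unitary_diag_form[OF W w, of "\<lambda>_. 1"] unitary_matD[OF W] w by simp
    \<comment> \<open>The order on complex numbers also demands vanishing imaginary parts, so the
      form is exhibited as a real number before real parts are compared. The contribution of
      \<open>C\<close> is \<open>C\<close> times the squared norm of \<open>w\<close>, the same for
      both tuples.\<close>
    have form_eq: "\<exists>t. ((W * mat_diag n (\<lambda>i. complex_of_real (f (z i))) * mat_adjoint W) *\<^sub>v w) \<bullet>c w = complex_of_real t \<and>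
        t = C * Re (w \<bullet>c w) + Re (\<Sum>k<n. cinner (?F (z k)) v * (?\<omega> W k * cnj (?\<omega> W k)))"
      if W: "unitary_mat n W" and z: "\<And>k. k < n \<Longrightarrow> z k \<in> E" for W z
    proof -
      have Q: "((W * mat_diag n (\<lambda>i. complex_of_real (f (z i))) * mat_adjoint W) *\<^sub>v w) \<bullet>c w =
          (\<Sum>k<n. complex_of_real (f (z k)) * (?\<omega> W k * cnj (?\<omega> W k)))" (is "?Q = _")
        by (rule unitary_diag_form[OF W w])
      also have "\<dots> = (\<Sum>k<n. complex_of_real C * (?\<omega> W k * cnj (?\<omega> W k)) + cinner (?F (z k)) v * (?\<omega> W k * cnj (?\<omega> W k)))"
        using f[OF z] by (intro sum.cong refl) (simp add: distrib_right)
      also have "\<dots> = complex_of_real C * (w \<bullet>c w) + (\<Sum>k<n. cinner (?F (z k)) v * (?\<omega> W k * cnj (?\<omega> W k)))"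
        unfolding norm_\<omega>[OF W, symmetric] by (simp only: sum.distrib sum_distrib_left)
      finally have "Re ?Q = C * Re (w \<bullet>c w) + Re (\<Sum>k<n. cinner (?F (z k)) v * (?\<omega> W k * cnj (?\<omega> W k)))" by simp
      moreover have "?Q = complex_of_real (\<Sum>k<n. f (z k) * (cmod (?\<omega> W k))\<^sup>2)"
        unfolding Q of_real_sum of_real_mult complex_norm_square ..
      ultimately show ?thesis by auto
    qed
    have "((joint_calculus n f T - joint_calculus n f S) *\<^sub>v w) \<bullet>c w =
        (joint_calculus n f T *\<^sub>v w) \<bullet>c w - (joint_calculus n f S *\<^sub>v w) \<bullet>c w"
      using carrier w by (subst minus_mult_distrib_mat_vec[of _ n n]) (auto intro!: minus_scalar_prod_distrib[of _ n])
    then show "0 \<le> ((joint_calculus n f T - joint_calculus n f S) *\<^sub>v w) \<bullet>c w"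
      using form_eq[OF U xE] form_eq[OF V yE] le_gh unfolding gS hT calc
      by (auto simp: less_eq_complex_def)
  qed
qed

theorem theorem1p24:
  fixes D :: "'a::complex_hilbert_space set"
    and X :: "'a \<Rightarrow> 'a"
    and P :: "'d::finite \<Rightarrow> 'a \<Rightarrow> 'a"
    and v :: 'a
    and C :: real
    and F :: "('d \<Rightarrow> complex) \<Rightarrow> complex"
    and E :: "('d \<Rightarrow> real) set"
  assumes "self_adjoint_operator D X"
    and "orthogonal_resolution P"
    and "\<And>z. z \<in> mu_resolvent D X P \<Longrightarrow>
           F z = complex_of_real C + cinner (inv_into D (pencil X P z) v) v"
    and "open_box E"
    and "complexify ` E \<subseteq> mu_resolvent D X P"
  shows "(\<forall>x\<in>E. F (complexify x) \<in> \<real>) \<and>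
         globally_operator_monotone E (\<lambda>x. Re (F (complexify x)))"
proof -
  have F: "F (complexify x) = complex_of_real C + cinner (inv_into D (pencil X P (complexify x)) v) v"
    and real: "F (complexify x) \<in> \<real>" if "x \<in> E" for x
  proof -
    have z: "complexify x \<in> mu_resolvent D X P" using assms(5) that by auto
    show F: "F (complexify x) = complex_of_real C + cinner (inv_into D (pencil X P (complexify x)) v) v"
      by (rule assms(3)[OF z])
    \<comment> \<open>Symmetry of the resolvent at a real point makes this number equal to its
      conjugate.\<close>
    have "cinner (inv_into D (pencil X P (complexify x)) v) v \<in> \<real>"
      unfolding Reals_cnj_iff cinner_commute[symmetric]
      using resolvent_symmetric[OF assms(1,2) z, of v v] by simp
    then show "F (complexify x) \<in> \<real>" unfolding F by simp
  qed
  have "complex_of_real (Re (F (complexify x))) =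
      complex_of_real C + cinner (inv_into D (pencil X P (complexify x)) v) v" if "x \<in> E" for x
    using F[OF that] of_real_Re[OF real[OF that]] by simp
  from joint_calculus_le_on_box[OF assms(1,2,4,5) _ _ _ _ _ this] real
  show ?thesis unfolding globally_operator_monotone_def by blast
qed

end
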